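(* Let $(X,T)$ be an essentially minimal Cantor system of finite topological rank, and let $(Y,S)$ be a minimal system on a Cantor set such that for some continuous map $\alpha: X\to Y$ one has $\alpha\circ T=S\circ\alpha$. Then $\mathrm{rank}_{\mathrm{top}}(Y,S)<\infty$.
   Context: A topological dynamical system is a pair $(X,T)$ with $X$ a (nonempty) compact metric space and $T:X\to X$ a homeomorphism. It is a Cantor system if $X$ is a Cantor space (nonempty, compact, metrizable, totally disconnected, without isolated points). A subsystem is a nonempty closed invariant subset $Z$ with the restriction of $T$. The system is minimal if every orbit $\{T^n x\}_{n\in\mathbb Z}$ is dense, and essentially minimal if it has a unique minimal subsystem. Topological rank. Let $X$ be a compact totally disconnected metrizable space and $(X,T)$ essentially minimal. A Kakutani-Rokhlin partition is a finite partition of $X$ into nonempty clopen sets of the form $\{T^{j}B_{i} : 1\le i\le k,\ 0\le j<h_i\}$; for each $i$ the family $\{T^jB_i:0\le j<h_i\}$ is called a tower, and $\bigcup_{i=1}^k B_i$ is the base. A realization of $(X,T)$ is a sequence $(\mathcal T_n)_{n\ge1}$ of Kakutani-Rokhlin partitions such that $\mathcal T_{n+1}$ refines $\mathcal T_n$, the base of $\mathcal T_{n+1}$ is contained in the base of $\mathcal T_n$, the intersection of all the bases is a single point, and $\bigcup_n\mathcal T_n$ generates the topology of $X$. Writing $\#\mathcal T_n$ for the number of towers of $\mathcal T_n$, the system has finite topological rank if it has a realization with $\max_n\#\mathcal T_n<\infty$; the topological rank $\mathrm{rank}_{\mathrm{top}}(X,T)$ is the minimum value of $\max_n\#\mathcal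 T_n$ over all such realizations, and it is $\infty$ if there are none. *)

theory Defs
  imports "HOL-Analysis.Analysis" "HOL-Library.Extended_Nat" "HOL-Library.Disjoint_Sets"
begin

text \<open>
  A system lives on a carrier set \<open>X\<close> of a metric space type, with the subspace topology
  \<^term>\<open>top_of_set X\<close>; the map \<open>T\<close> is only relevant on \<open>X\<close>.
\<close>

definition dynamical_system :: "'a::metric_space set \<Rightarrow> ('a \<Rightarrow> 'a) \<Rightarrow> bool" where
  "dynamical_system X T \<longleftrightarrow> X \<noteq> {} \<and> compact X \<and> (\<exists>T'. homeomorphism X X T T')"

definition totally_disconnected :: "'a::topological_space set \<Rightarrow> bool" where
  "totally_disconnected X \<longleftrightarrow> (\<forall>C. C \<subseteq> X \<and> connected C \<longrightarrow> (\<exists>x. C \<subseteq> {x}))"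

definition cantor_space :: "'a::metric_space set \<Rightarrow> bool" where
  "cantor_space X \<longleftrightarrow>
     X \<noteq> {} \<and> compact X \<and> totally_disconnected X \<and> (\<forall>x\<in>X. x islimpt X)"

definition cantor_system :: "'a::metric_space set \<Rightarrow> ('a \<Rightarrow> 'a) \<Rightarrow> bool" where
  "cantor_system X T \<longleftrightarrow> dynamical_system X T \<and> cantor_space X"

definition int_iterate :: "'a set \<Rightarrow> ('a \<Rightarrow> 'a) \<Rightarrow> int \<Rightarrow> 'a \<Rightarrow> 'a" where
  "int_iterate X T n =
     (if 0 \<le> n then T ^^ nat n else (inv_into X T) ^^ nat (- n))"

definition full_orbit :: "'a set \<Rightarrow> ('a \<Rightarrow> 'a) \<Rightarrow> 'a \<Rightarrow> 'a set" where
  "full_orbit X T x = range (\<lambda>n. int_iterate X T n x)"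

definition minimal_system :: "'a::metric_space set \<Rightarrow> ('a \<Rightarrow> 'a) \<Rightarrow> bool" where
  "minimal_system X T \<longleftrightarrow>
     dynamical_system X T \<and> (\<forall>x\<in>X. X \<subseteq> closure (full_orbit X T x))"

text \<open>
  Invariance is \<open>T ` Z = Z\<close>, so that the restriction of \<open>T\<close> to \<open>Z\<close> is again a homeomorphism.
\<close>

definition subsystem :: "'a::metric_space set \<Rightarrow> ('a \<Rightarrow> 'a) \<Rightarrow> 'a set \<Rightarrow> bool" where
  "subsystem X T Z \<longleftrightarrow> Z \<noteq> {} \<and> closedin (top_of_set X) Z \<and> T ` Z = Z"

definition essentially_minimal :: "'a::metric_space set \<Rightarrow> ('a \<Rightarrow> 'a) \<Rightarrow> bool" where
  "essentially_minimal X T \<longleftrightarrow>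
     dynamical_system X T \<and> (\<exists>!Z. subsystem X T Z \<and> minimal_system Z T)"

text \<open>
  A Kakutani-Rokhlin partition is given by the finite set of the pairs \<open>(B\<^sub>i, h\<^sub>i)\<close>, one for each
  tower, because the partition alone does not determine the towers. The injectivity condition
  says that the levels \<open>T\<^sup>j B\<^sub>i\<close> are distinct (hence, with \<^const>\<open>partition_on\<close>, disjoint) for
  distinct indices; in particular distinct towers have distinct bases.
\<close>

type_synonym 'a towers = "('a set \<times> nat) set"

definition levels :: "('a \<Rightarrow> 'a) \<Rightarrow> 'a towers \<Rightarrow> 'a set set" where
  "levels T P = {(T ^^ j) ` B | B h j. (B, h) \<in> P \<and> j < h}"

definition tower_base :: "'a towers \<Rightarrow> 'a set" where
  "tower_base P = \<Union> (fst ` P)"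

definition KR_partition ::
    "'a::metric_space set \<Rightarrow> ('a \<Rightarrow> 'a) \<Rightarrow> 'a towers \<Rightarrow> bool" where
  "KR_partition X T P \<longleftrightarrow>
     finite P \<and> (\<forall>(B, h)\<in>P. 0 < h) \<and>
     partition_on X (levels T P) \<and>
     inj_on (\<lambda>((B, h), j). (T ^^ j) ` B) (SIGMA p:P. {..<snd p}) \<and>
     (\<forall>C\<in>levels T P. openin (top_of_set X) C \<and> closedin (top_of_set X) C)"

definition realization ::
    "'a::metric_space set \<Rightarrow> ('a \<Rightarrow> 'a) \<Rightarrow> (nat \<Rightarrow> 'a towers) \<Rightarrow> bool" where
  "realization X T P \<longleftrightarrow>
     (\<forall>n. KR_partition X T (P n)) \<and>
     (\<forall>n. refines X (levels T (P (Suc n))) (levels T (P n))) \<and>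
     (\<forall>n. tower_base (P (Suc n)) \<subseteq> tower_base (P n)) \<and>
     (\<exists>x. (\<Inter>n. tower_base (P n)) = {x}) \<and>
     topology_generated_by (\<Union>n. levels T (P n)) = top_of_set X"

definition max_towers :: "(nat \<Rightarrow> 'a towers) \<Rightarrow> enat" where
  "max_towers P = (SUP n. enat (card (P n)))"

definition finite_topological_rank :: "'a::metric_space set \<Rightarrow> ('a \<Rightarrow> 'a) \<Rightarrow> bool" where
  "finite_topological_rank X T \<longleftrightarrow> (\<exists>P. realization X T P \<and> max_towers P < \<infinity>)"

text \<open>
  The infimum of a nonempty set in \<^typ>\<open>enat\<close> is attained, and that of the empty set is \<open>\<infinity>\<close>.
\<close>

definition topological_rank :: "'a::metric_space set \<Rightarrow> ('a \<Rightarrow> 'a) \<Rightarrow> enat" where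
  "topological_rank X T = Inf {max_towers P | P. realization X T P \<and> max_towers P < \<infinity>}"

lemma topological_rank_less_infinity_iff:
  "topological_rank X T < \<infinity> \<longleftrightarrow> finite_topological_rank X T"
  unfolding topological_rank_def finite_topological_rank_def Inf_less_iff by blast

end

theory Submission
  imports Defs "HOL-Library.Sublist"
begin

text \<open>
  The towers of a fine Kakutani-Rokhlin partition of \<open>X\<close> provide \<open>d\<close> words such that all
  itineraries in \<open>Y\<close>, for a given locally constant coding, are read along concatenations of these
  words. Replacing \<open>vu\<close> by \<open>u\<close> whenever \<open>v\<close> and \<open>vu\<close> are both in the set, one may take the words
  to be a prefix code. To a point \<open>y\<close> assign the set \<open>state y\<close> of all proper prefixes of words in
  which a parsing of its past may end at time \<open>0\<close>. Reading a letter maps the state of \<open>y\<close>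
  onto the state of \<open>S y\<close>, so its cardinality does not increase along orbits; as the state is also
  upper semicontinuous, minimality forces the cardinality to be constant and the state to be
  locally constant. No recognizability is needed.

  The letter read at \<open>y\<close> is determined by its state unless every member of the state is a branching
  node of the tree of prefixes, and a prefix code of \<open>d\<close> words has at most \<open>d\<^sup>2\<close> of these.
  Hence the first return to the clopen set of points with a branching state (or with one further
  chosen state) follows one of boundedly many itineraries, depending only on the current state and
  letter. To keep this clopen set inside a given clopen set \<open>U\<close>, the letter at \<open>y\<close> records
  the whole itinerary up to the next visit to \<open>U\<close>, so that only letters at times in \<open>U\<close> are ever
  undetermined. As the bound depends on \<open>d\<close> alone, iterating gives a realization of \<open>Y\<close>.
\<close>

section \<open>Combinatorics of reading along a finite set of words\<close>

section \<open>Parsing words\<close>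

definition concats :: "'a list set \<Rightarrow> 'a list set" where
  "concats W = concat ` lists W"

text \<open>Positions inside an unfinished word: the inner vertices of the prefix tree of
  \<open>W\<close>. A word just completed is represented by the root \<open>[]\<close>.\<close>

definition nodes :: "'a list set \<Rightarrow> 'a list set" where
  "nodes W = {n. \<exists>w\<in>W. strict_prefix n w}"

definition can_read :: "'a list set \<Rightarrow> 'a list \<Rightarrow> 'a \<Rightarrow> bool" where
  "can_read W n a \<longleftrightarrow> (\<exists>w\<in>W. prefix (n @ [a]) w)"

definition advance :: "'a list set \<Rightarrow> 'a \<Rightarrow> 'a list \<Rightarrow> 'a list" where
  "advance W a n = (if n @ [a] \<in> W then [] else n @ [a])"

text \<open>With \<open>suffix\<close> in place of equality, the block \<open>p\<close> may begin in
  the middle of a word; only the position reached at its end is recorded.\<close>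

definition parse_states :: "'a list set \<Rightarrow> 'a list \<Rightarrow> 'a list set" where
  "parse_states W p = {n \<in> nodes W. \<exists>u\<in>concats W. suffix p (u @ n)}"

definition branching :: "'a list set \<Rightarrow> 'a list set" where
  "branching W = {n. \<exists>a b. a \<noteq> b \<and> can_read W n a \<and> can_read W n b}"

definition prefix_code :: "'a list set \<Rightarrow> bool" where
  "prefix_code W \<longleftrightarrow> [] \<notin> W \<and> (\<forall>v\<in>W. \<forall>w\<in>W. prefix v w \<longrightarrow> v = w)"

lemma concats_append: "u \<in> concats W \<Longrightarrow> v \<in> concats W \<Longrightarrow> u @ v \<in> concats W"
proof -
  assume "u \<in> concats W" "v \<in> concats W"
  then obtain us vs where "us \<in> lists W" "vs \<in> lists W" "u = concat us" "v = concat vs"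
    unfolding concats_def by auto
  then show ?thesis unfolding concats_def by (intro image_eqI[of _ _ "us @ vs"]) auto
qed

lemma concats_word: "w \<in> W \<Longrightarrow> w \<in> concats W"
  unfolding concats_def by (rule image_eqI[of _ _ "[w]"]) auto

lemma Nil_concats: "[] \<in> concats W"
  unfolding concats_def by (rule image_eqI[of _ _ "[]"]) auto

lemma concats_snocE:
  assumes "u \<in> concats W" "u \<noteq> []" "[] \<notin> W"
  obtains v w where "v \<in> concats W" "w \<in> W" "u = v @ w"
proof -
  obtain ws where ws: "ws \<in> lists W" "u = concat ws"
    using assms(1) unfolding concats_def by auto
  then have "ws \<noteq> []" using assms(2) by auto
  then obtain vs w where "ws = vs @ [w]" by (metis rev_exhaust)
  then show ?thesis using ws by (intro that[of "concat vs" w]) (auto simp: concats_def)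
qed

lemma finite_nodes: "finite W \<Longrightarrow> finite (nodes W)"
proof -
  assume "finite W"
  moreover have "nodes W \<subseteq> (\<Union>w\<in>W. set (prefixes w))"
    unfolding nodes_def by (auto simp: strict_prefix_def)
  ultimately show ?thesis by (auto intro: finite_subset)
qed

lemma suffix_append_snoc: "suffix (p @ [a]) (u @ n @ [b]) \<longleftrightarrow> a = b \<and> suffix p (u @ n)"
  using snoc_suffix_snoc[of p a "u @ n" b] by simp

text \<open>The last letter either completes a word, which leads back to the root, or prolongs an
  unfinished one. As no word is a proper prefix of another, the test in \<open>advance\<close> tells
  the two cases apart.\<close>

lemma parse_states_snoc:
  assumes W: "prefix_code W"
  shows "parse_states W (p @ [a]) = advance W a ` {n \<in> parse_states W p. can_read W n a}"
proof (intro equalityI subsetI)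
  fix n' assume "n' \<in> parse_states W (p @ [a])"
  then obtain u where n': "n' \<in> nodes W" and u: "u \<in> concats W" "suffix (p @ [a]) (u @ n')"
    unfolding parse_states_def by auto
  show "n' \<in> advance W a ` {n \<in> parse_states W p. can_read W n a}"
  proof (cases n' rule: rev_cases)
    case Nil
    then have "suffix (p @ [a]) u" using u by simp
    then have "u \<noteq> []" by auto
    then obtain v w where vw: "v \<in> concats W" "w \<in> W" "u = v @ w"
      using concats_snocE[of u W] u(1) W unfolding prefix_code_def by metis
    then obtain n b where w: "w = n @ [b]" using W unfolding prefix_code_def by (metis rev_exhaust)
    then have ab: "b = a" "suffix p (v @ n)" using \<open>suffix (p @ [a]) u\<close> vw
      by (simp_all add: suffix_append_snoc)
    have "n \<in> nodes W" unfolding nodes_def using vw w by (auto intro!: bexI[of _ w] simp: strict_prefix_def)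
    then have "n \<in> parse_states W p" unfolding parse_states_def using vw ab by auto
    moreover have "can_read W n a" unfolding can_read_def using vw w ab by auto
    ultimately show ?thesis using Nil vw w ab by (auto simp: advance_def image_iff intro!: exI[of _ n])
  next
    case (snoc n b)
    then have ab: "b = a" "suffix p (u @ n)" using u by (simp_all add: suffix_append_snoc)
    obtain w where w: "w \<in> W" "strict_prefix (n @ [a]) w" using n' snoc ab unfolding nodes_def by auto
    then have "n @ [a] \<notin> W" using W unfolding prefix_code_def strict_prefix_def by blast
    moreover have "strict_prefix n w" using w(2) by (intro prefix_snocD[of n a]) (simp add: strict_prefix_def)
    then have "n \<in> nodes W" unfolding nodes_def using w by auto
    then have "n \<in> parse_states W p" unfolding parse_states_def using u ab by auto
    moreover have "can_read W n a" unfolding can_read_def using w by (auto simp: strict_prefix_def)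
    ultimately show ?thesis using snoc ab by (auto simp: advance_def image_iff intro!: exI[of _ n])
  qed
next
  fix n' assume "n' \<in> advance W a ` {n \<in> parse_states W p. can_read W n a}"
  then obtain n u w where n: "n' = advance W a n" and u: "u \<in> concats W" "suffix p (u @ n)"
    and w: "w \<in> W" "prefix (n @ [a]) w" unfolding parse_states_def can_read_def by auto
  show "n' \<in> parse_states W (p @ [a])"
  proof (cases "n @ [a] \<in> W")
    case True
    then have "n' = []" using n by (simp add: advance_def)
    moreover have "[] \<in> nodes W" unfolding nodes_def using True by (auto intro!: bexI[of _ "n @ [a]"] simp: strict_prefix_def)
    moreover have "u @ n @ [a] \<in> concats W" using concats_append[OF u(1) concats_word[OF True]] .
    moreover have "suffix (p @ [a]) (u @ n @ [a])" using u(2) by (simp add: suffix_append_snoc)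
    ultimately show ?thesis unfolding parse_states_def by auto
  next
    case False
    then have "n' = n @ [a]" using n by (simp add: advance_def)
    moreover have "n @ [a] \<in> nodes W" unfolding nodes_def using w False
      by (auto simp: strict_prefix_def)
    moreover have "suffix (p @ [a]) (u @ n @ [a])" using u(2) by (simp add: suffix_append_snoc)
    ultimately show ?thesis unfolding parse_states_def using u by auto
  qed
qed

lemma parse_states_suffix: "suffix p q \<Longrightarrow> parse_states W q \<subseteq> parse_states W p"
  unfolding parse_states_def by (auto intro: suffix_order.trans)

text \<open>The end of \<open>v\<close> cuts at most one word, whose initial part is the node. If
  nothing is cut, the node is \<open>[]\<close>, which requires a nonempty word in
  \<open>W\<close>.\<close>

lemma prefix_concats:
  assumes "prefix v (concat ws)" "ws \<in> lists W" "W - {[]} \<noteq> {}"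
  shows "\<exists>u\<in>concats W. \<exists>n\<in>nodes W. v = u @ n"
  using assms(1,2)
proof (induction ws arbitrary: v)
  case Nil
  then have "v = []" by simp
  moreover obtain w where "w \<in> W" "w \<noteq> []" using assms(3) by auto
  then have "[] \<in> nodes W" unfolding nodes_def by (auto intro!: bexI[of _ w] simp: strict_prefix_def)
  ultimately show ?case using Nil_concats by force
next
  case (Cons w ws)
  then have w: "w \<in> W" by simp
  have "prefix v (w @ concat ws)" using Cons.prems by simp
  then consider "strict_prefix v w" | v' where "v = w @ v'" "prefix v' (concat ws)"
    by (metis prefix_append strict_prefixI prefix_order.refl append_Nil2 Nil_prefix)
  then show ?case
  proof cases
    case 1
    then have "v \<in> nodes W" unfolding nodes_def using w by auto
    then show ?thesis using Nil_concats by force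
  next
    case 2
    then obtain u n where "u \<in> concats W" "n \<in> nodes W" "v' = u @ n"
      using Cons.IH[of v'] Cons.prems by auto
    then have "w @ u \<in> concats W" "v = (w @ u) @ n" using concats_append[OF concats_word[OF w]] 2 by auto
    then show ?thesis using \<open>n \<in> nodes W\<close> by blast
  qed
qed

lemma parse_states_nonempty:
  assumes "sublist p u" "u \<in> concats W" "W - {[]} \<noteq> {}"
  shows "parse_states W p \<noteq> {}"
proof -
  obtain ws where ws: "ws \<in> lists W" "u = concat ws" using assms(2) unfolding concats_def by auto
  obtain v where "prefix v u" "suffix p v" using assms(1) by (auto simp: sublist_altdef)
  then obtain u' n where "u' \<in> concats W" "n \<in> nodes W" "v = u' @ n"
    using prefix_concats ws assms(3) by blast
  then show ?thesis using \<open>suffix p v\<close> unfolding parse_states_def by auto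
qed

lemma card_can_read:
  assumes "finite W"
  shows "finite {a. can_read W n a}" "card {a. can_read W n a} \<le> card W"
proof -
  \<comment> \<open>A letter readable at \<open>n\<close> stands at index \<open>length n\<close> of
    some word.\<close>
  have *: "{a. can_read W n a} \<subseteq> (\<lambda>w. w ! length n) ` W"
    unfolding can_read_def by (force simp: prefix_def nth_append)
  show "finite {a. can_read W n a}" using * assms by (auto intro: finite_subset)
  show "card {a. can_read W n a} \<le> card W"
    using * assms by (meson surj_card_le)
qed

text \<open>A branching node is where two words part, hence their longest common prefix.\<close>

lemma branching_subset:
  "branching W \<subseteq> (\<lambda>(v, w). longest_common_prefix v w) ` (W \<times> W)"
proof
  fix n assume "n \<in> branching W"
  then obtain a b v w where ab: "a \<noteq> b" and v: "v \<in> W" "prefix (n @ [a]) v"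
    and w: "w \<in> W" "prefix (n @ [b]) w" unfolding branching_def can_read_def by auto
  have "longest_common_prefix (n @ a # xs) (n @ b # ys) = n" for xs ys
    using ab by (induction n) auto
  then have "n = longest_common_prefix v w" using v w by (auto simp: prefix_def)
  then show "n \<in> (\<lambda>(v, w). longest_common_prefix v w) ` (W \<times> W)" using v w by auto
qed

lemma card_branching:
  assumes "finite W"
  shows "finite (branching W)" "card (branching W) \<le> card W ^ 2"
proof -
  have fin: "finite (W \<times> W)" using assms by simp
  show "finite (branching W)" by (rule finite_surj[OF fin branching_subset])
  have "card (branching W) \<le> card (W \<times> W)" using surj_card_le[OF fin branching_subset] .
  then show "card (branching W) \<le> card W ^ 2" by (simp add: power2_eq_square card_cartesian_product)
qed

text \<open>If \<open>v\<close> and \<open>v @ u\<close> are words, \<open>u\<close> may replace the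
  latter: it remains a concatenation, and the total length drops because \<open>v\<close> is
  nonempty. The number of words does not grow, so bounds in \<open>d\<close> survive.\<close>

lemma exists_prefix_code:
  fixes W :: "'a list set"
  assumes "finite W" "[] \<notin> W"
  shows "\<exists>V. finite V \<and> card V \<le> card W \<and> prefix_code V \<and> concats W \<subseteq> concats V"
  using assms
proof (induction "\<Sum>w\<in>W. length w" arbitrary: W rule: less_induct)
  case less
  show ?case
  proof (cases "prefix_code W")
    case True
    then show ?thesis using less.prems by blast
  next
    case False
    then obtain v u where vu: "v \<in> W" "v @ u \<in> W" "u \<noteq> []"
      using less.prems unfolding prefix_code_def prefix_def by auto
    define w where "w = v @ u"
    define V where "V = insert u (W - {w})"
    have v: "v \<noteq> []" "v \<noteq> w" using vu less.prems by (auto simp: w_def)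
    have w: "w \<in> W" using vu w_def by simp
    have V: "finite V" "[] \<notin> V" using less.prems vu by (auto simp: V_def)
    \<comment> \<open>Only an inequality, since \<open>u\<close> may already belong to
      \<open>W - {w}\<close>.\<close>
    have "(\<Sum>w\<in>V. length w) \<le> length u + (\<Sum>w\<in>W - {w}. length w)"
      unfolding V_def using less.prems by (simp add: sum.insert_if)
    also have "\<dots> < length w + (\<Sum>w\<in>W - {w}. length w)"
      using v by (simp add: w_def)
    also have "\<dots> = (\<Sum>w\<in>W. length w)" using less.prems w by (simp add: sum.remove)
    finally have lt: "(\<Sum>w\<in>V. length w) < (\<Sum>w\<in>W. length w)" .
    have card: "card V \<le> card W"
      unfolding V_def using less.prems w
      by (metis card_Suc_Diff1 card_insert_le_m1 finite_Diff card_gt_0_iff diff_Suc_1 empty_iff order_refl)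
    have word: "x \<in> concats V" if "x \<in> W" for x
    proof (cases "x = w")
      case True
      have "v \<in> V" "u \<in> V" using vu v by (auto simp: V_def)
      then show ?thesis using True concats_append[OF concats_word concats_word] w_def by metis
    next
      case False
      then show ?thesis using that by (intro concats_word) (auto simp: V_def)
    qed
    have "concat ws \<in> concats V" if "ws \<in> lists W" for ws
      using that by (induction ws) (auto intro: Nil_concats concats_append word)
    then have "concats W \<subseteq> concats V" unfolding concats_def[of W] by auto
    moreover obtain V' where "finite V'" "card V' \<le> card V" "prefix_code V'" "concats V \<subseteq> concats V'"
      using less.hyps[OF lt V] by blast
    ultimately show ?thesis using card by (meson le_trans subset_trans)
  qed
qed

section \<open>Clopen partitions, expressed by functions with discrete values\<close>

section \<open>Locally constant functions\<close>

text \<open>Continuity into a discrete space, phrased without a topology on the type of values; the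
  fibres are clopen.\<close>

definition locally_constant_on :: "'a::topological_space set \<Rightarrow> ('a \<Rightarrow> 'b) \<Rightarrow> bool" where
  "locally_constant_on Y g \<longleftrightarrow>
     (\<forall>y\<in>Y. \<exists>V. openin (top_of_set Y) V \<and> y \<in> V \<and> (\<forall>z\<in>V. g z = g y))"

lemma locally_constant_onD:
  assumes "locally_constant_on Y g" "y \<in> Y"
  obtains V where "openin (top_of_set Y) V" "y \<in> V" "\<And>z. z \<in> V \<Longrightarrow> g z = g y"
proof -
  have "\<exists>V. openin (top_of_set Y) V \<and> y \<in> V \<and> (\<forall>z\<in>V. g z = g y)"
    using assms unfolding locally_constant_on_def by (rule bspec)
  then show ?thesis using that by blast
qed

lemma locally_constant_on_const: "locally_constant_on Y (\<lambda>y. c)"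
  unfolding locally_constant_on_def by (metis openin_subtopology_self)

lemma locally_constant_on_combine:
  assumes "locally_constant_on Y g" "locally_constant_on Y h"
  shows "locally_constant_on Y (\<lambda>y. F (g y) (h y))"
  unfolding locally_constant_on_def
proof
  fix y assume y: "y \<in> Y"
  obtain V where V: "openin (top_of_set Y) V" "y \<in> V" "\<And>z. z \<in> V \<Longrightarrow> g z = g y"
    using locally_constant_onD[OF assms(1) y] by blast
  obtain W where W: "openin (top_of_set Y) W" "y \<in> W" "\<And>z. z \<in> W \<Longrightarrow> h z = h y"
    using locally_constant_onD[OF assms(2) y] by blast
  have "openin (top_of_set Y) (V \<inter> W)" "y \<in> V \<inter> W" using V W by (blast intro: openin_Int)+
  moreover have "F (g z) (h z) = F (g y) (h y)" if "z \<in> V \<inter> W" for z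
    using V(3)[of z] W(3)[of z] that by simp
  ultimately show "\<exists>V. openin (top_of_set Y) V \<and> y \<in> V \<and> (\<forall>z\<in>V. F (g z) (h z) = F (g y) (h y))"
    by blast
qed

lemma locally_constant_on_compose:
  assumes "locally_constant_on Y g" "continuous_on X f" "f ` X \<subseteq> Y"
  shows "locally_constant_on X (\<lambda>x. g (f x))"
  unfolding locally_constant_on_def
proof
  fix x assume x: "x \<in> X"
  then have "f x \<in> Y" using assms(3) by auto
  then obtain V where V: "openin (top_of_set Y) V" "f x \<in> V" "\<And>z. z \<in> V \<Longrightarrow> g z = g (f x)"
    using locally_constant_onD[OF assms(1)] by blast
  have "openin (top_of_set X) (X \<inter> f -` V)"
    using assms V(1) by (intro continuous_openin_preimage) auto
  then show "\<exists>V. openin (top_of_set X) V \<and> x \<in> V \<and> (\<forall>z\<in>V. g (f z) = g (f x))"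
    using V x by (intro exI[of _ "X \<inter> f -` V"]) blast
qed

text \<open>The function \<open>h\<close> may depend on \<open>y\<close>, which suits codings that
  look ahead for a time varying with the point.\<close>

lemma locally_constant_on_of_coarser:
  assumes "\<And>y. y \<in> Y \<Longrightarrow> \<exists>h. locally_constant_on Y (h :: _ \<Rightarrow> 'c) \<and> (\<forall>z\<in>Y. h z = h y \<longrightarrow> g z = g y)"
  shows "locally_constant_on Y g"
  unfolding locally_constant_on_def
proof
  fix y assume y: "y \<in> Y"
  then obtain h :: "_ \<Rightarrow> 'c" where h: "locally_constant_on Y h" "\<forall>z\<in>Y. h z = h y \<longrightarrow> g z = g y"
    using assms by blast
  obtain V where V: "openin (top_of_set Y) V" "y \<in> V" "\<And>z. z \<in> V \<Longrightarrow> h z = h y"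
    using locally_constant_onD[OF h(1) y] by blast
  have "g z = g y" if "z \<in> V" for z
    using V(3)[OF that] h(2) openin_imp_subset[OF V(1)] that by blast
  then show "\<exists>V. openin (top_of_set Y) V \<and> y \<in> V \<and> (\<forall>z\<in>V. g z = g y)"
    using V by blast
qed

lemma locally_constant_on_openin:
  assumes "locally_constant_on Y g"
  shows "openin (top_of_set Y) {y \<in> Y. P (g y)}"
proof (subst openin_subopen, clarify)
  fix y assume y: "y \<in> Y" "P (g y)"
  obtain V where V: "openin (top_of_set Y) V" "y \<in> V" "\<And>z. z \<in> V \<Longrightarrow> g z = g y"
    using locally_constant_onD[OF assms y(1)] by blast
  have "P (g z)" "z \<in> Y" if "z \<in> V" for z
    using V(3)[OF that] y(2) openin_imp_subset[OF V(1)] that by auto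
  then show "\<exists>V. openin (top_of_set Y) V \<and> y \<in> V \<and> V \<subseteq> {y \<in> Y. P (g y)}"
    using V(1,2) by blast
qed

lemma locally_constant_on_closedin:
  assumes "locally_constant_on Y g"
  shows "closedin (top_of_set Y) {y \<in> Y. P (g y)}"
proof -
  have "Y - {y \<in> Y. P (g y)} = {y \<in> Y. \<not> P (g y)}" by auto
  then show ?thesis using locally_constant_on_openin[OF assms, of "\<lambda>a. \<not> P a"]
    by (simp add: closedin_def)
qed

lemma locally_constant_on_clopen:
  assumes "openin (top_of_set Y) K" "closedin (top_of_set Y) K"
  shows "locally_constant_on Y (\<lambda>y. y \<in> K)"
  unfolding locally_constant_on_def
proof
  fix y assume y: "y \<in> Y"
  show "\<exists>V. openin (top_of_set Y) V \<and> y \<in> V \<and> (\<forall>z\<in>V. (z \<in> K) = (y \<in> K))"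
  proof (cases "y \<in> K")
    case True
    then show ?thesis using assms by auto
  next
    case False
    have "openin (top_of_set Y) (Y - K)" using assms by (simp add: closedin_def)
    then show ?thesis using False y by (intro exI[of _ "Y - K"]) auto
  qed
qed

lemma locally_constant_on_members:
  assumes "finite F" "\<And>K. K \<in> F \<Longrightarrow> openin (top_of_set Y) K" "\<And>K. K \<in> F \<Longrightarrow> closedin (top_of_set Y) K"
  shows "locally_constant_on Y (\<lambda>y. {K \<in> F. y \<in> K})"
  using assms
proof (induction F rule: finite_induct)
  case empty
  show ?case by (simp add: locally_constant_on_const)
next
  case (insert K F)
  have "locally_constant_on Y (\<lambda>y. y \<in> K)" using insert.prems by (intro locally_constant_on_clopen) auto
  moreover have "locally_constant_on Y (\<lambda>y. {K \<in> F. y \<in> K})" using insert by auto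
  ultimately have "locally_constant_on Y (\<lambda>y. if y \<in> K then insert K {K \<in> F. y \<in> K} else {K \<in> F. y \<in> K})"
    by (rule locally_constant_on_combine[where F = "\<lambda>b A. if b then insert K A else A"])
  moreover have "(if y \<in> K then insert K {K \<in> F. y \<in> K} else {K \<in> F. y \<in> K}) =
      {L \<in> insert K F. y \<in> L}" for y by auto
  ultimately show ?case by simp
qed

lemma locally_constant_on_map:
  assumes "\<And>i. i \<in> set xs \<Longrightarrow> locally_constant_on Y (g i)"
  shows "locally_constant_on Y (\<lambda>y. map (\<lambda>i. g i y) xs)"
  using assms
proof (induction xs)
  case (Cons i xs)
  have "locally_constant_on Y (\<lambda>y. g i y # map (\<lambda>i. g i y) xs)"
    by (rule locally_constant_on_combine[where F = "(#)"]) (use Cons in auto)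
  then show ?case by simp
qed (simp add: locally_constant_on_const)

lemma compact_finite_subcover:
  assumes "compact Y" "\<And>y. y \<in> Y \<Longrightarrow> openin (top_of_set Y) (K y)" "\<And>y. y \<in> Y \<Longrightarrow> y \<in> K y"
  obtains D where "finite D" "D \<subseteq> Y" "Y \<subseteq> (\<Union>y\<in>D. K y)"
proof -
  have "\<forall>c\<in>K ` Y. openin (top_of_set Y) c" "Y \<subseteq> \<Union>(K ` Y)" using assms by auto
  then obtain E where "E \<subseteq> K ` Y" "finite E" "Y \<subseteq> \<Union>E"
    using assms(1) unfolding compact_eq_openin_cover by meson
  then show ?thesis using that by (metis finite_subset_image)
qed

text \<open>Connected subsets have at most one point, so none joins \<open>y\<close> to the
  complement of \<open>V\<close>; in a compact Hausdorff space, closed sets not joined by a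
  connected set are separated by a clopen one.\<close>

lemma clopen_neighbourhood:
  fixes Y :: "'a::metric_space set"
  assumes "compact Y" "totally_disconnected Y" "y \<in> Y" "open V" "y \<in> V"
  shows "\<exists>K. openin (top_of_set Y) K \<and> closedin (top_of_set Y) K \<and> y \<in> K \<and> K \<subseteq> V"
proof -
  have "disjnt C {y} \<or> disjnt C (Y - V)" if "connectedin (top_of_set Y) C" for C
  proof -
    have "C \<subseteq> Y" "connected C" using that by (auto simp: connectedin_subtopology)
    then obtain x where "C \<subseteq> {x}" using assms(2) unfolding totally_disconnected_def by blast
    then show ?thesis using assms(5) by (auto simp: disjnt_iff)
  qed
  moreover have "closedin (top_of_set Y) (Y - V)"
    using assms(4) by (metis closedin_closed_Int closed_Compl Diff_eq)
  moreover have "closedin (top_of_set Y) {y}"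
    using assms(3) by (metis closedin_closed_Int closed_singleton Int_insert_right_if1 Int_empty_right)
  moreover have "Hausdorff_space (top_of_set Y)"
    by (simp add: Hausdorff_space_euclidean Hausdorff_space_subtopology)
  moreover have "compact_space (top_of_set Y)"
    using assms(1) by (simp add: compact_space_subtopology)
  ultimately have "separated_between (top_of_set Y) {y} (Y - V)"
    by (intro cut_wire_fence_theorem)
  then obtain K where "closedin (top_of_set Y) K" "openin (top_of_set Y) K" "{y} \<subseteq> K" "disjnt K (Y - V)"
    unfolding separated_between by (auto simp: disjnt_def)
  then show ?thesis using openin_imp_subset by (fastforce simp: disjnt_iff)
qed

text \<open>The value type does not depend on \<open>e\<close>, so all stages of the later
  construction can use codings of one type.\<close>

lemma small_locally_constant:
  fixes Y :: "'a::metric_space set"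
  assumes "compact Y" "totally_disconnected Y" "e > 0"
  shows "\<exists>q :: 'a \<Rightarrow> 'a set set. locally_constant_on Y q \<and>
           (\<forall>y\<in>Y. \<forall>z\<in>Y. q y = q z \<longrightarrow> dist y z < e)"
proof -
  have "\<forall>y\<in>Y. \<exists>K. openin (top_of_set Y) K \<and> closedin (top_of_set Y) K \<and> y \<in> K \<and> K \<subseteq> ball y (e/2)"
    using assms by (intro ballI clopen_neighbourhood) auto
  then obtain K where K: "\<And>y. y \<in> Y \<Longrightarrow> openin (top_of_set Y) (K y) \<and> closedin (top_of_set Y) (K y)
      \<and> y \<in> K y \<and> K y \<subseteq> ball y (e/2)" by metis
  obtain D where D: "finite D" "D \<subseteq> Y" "Y \<subseteq> (\<Union>y\<in>D. K y)"
    using compact_finite_subcover[of Y K] assms(1) K by metis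
  \<comment> \<open>Overlaps in the cover are harmless: points with equal values share a member,
    contained in a ball of radius \<open>e/2\<close>.\<close>
  define q where "q y = {C \<in> K ` D. y \<in> C}" for y
  have "locally_constant_on Y q"
    unfolding q_def using D K by (intro locally_constant_on_members) auto
  moreover have "dist y z < e" if "y \<in> Y" "z \<in> Y" "q y = q z" for y z
  proof -
    obtain x where x: "x \<in> D" "y \<in> K x" using D \<open>y \<in> Y\<close> by auto
    then have "K x \<in> q y" by (auto simp: q_def)
    then have "z \<in> K x" using that by (auto simp: q_def)
    then have "dist x y < e/2" "dist x z < e/2" using x K D by (auto simp: subset_iff)
    then show ?thesis using dist_triangle_half_r[of x y e z] by simp
  qed
  ultimately show ?thesis by blast
qed

section \<open>First returns to clopen sets\<close>

section \<open>Return times and towers\<close>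

abbreviation itinerary :: "('a \<Rightarrow> 'a) \<Rightarrow> ('a \<Rightarrow> 'c) \<Rightarrow> nat \<Rightarrow> 'a \<Rightarrow> 'c list" where
  "itinerary T g k x \<equiv> map (\<lambda>j. g ((T ^^ j) x)) [0..<k]"

lemma itinerary_add: "itinerary T g (m + k) x = itinerary T g m x @ itinerary T g k ((T ^^ m) x)"
  by (induction k) (auto simp: funpow_add add.commute simp flip: add.assoc)

lemma levelI: "(B, h) \<in> P \<Longrightarrow> j < h \<Longrightarrow> (T ^^ j) ` B \<in> levels T P"
  unfolding levels_def by blast

lemma levelE:
  assumes "L \<in> levels T P"
  obtains B h j where "(B, h) \<in> P" "j < h" "L = (T ^^ j) ` B"
  using assms unfolding levels_def by blast

text \<open>The inverse is a parameter, so that backward orbits are iterates of \<open>S'\<close>;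
  \<open>inv_into_eq\<close> links it to \<open>int_iterate\<close>.\<close>

locale homeo_system =
  fixes Y :: "'a::metric_space set" and S S' :: "'a \<Rightarrow> 'a"
  assumes compact_space: "compact Y" and homeo: "homeomorphism Y Y S S'"
begin

lemma maps [simp]: "y \<in> Y \<Longrightarrow> S y \<in> Y" "y \<in> Y \<Longrightarrow> S' y \<in> Y"
  and inverses [simp]: "y \<in> Y \<Longrightarrow> S' (S y) = y" "y \<in> Y \<Longrightarrow> S (S' y) = y"
  using homeo by (auto simp: homeomorphism_def)

lemma iterates [simp]: "y \<in> Y \<Longrightarrow> (S ^^ n) y \<in> Y" "y \<in> Y \<Longrightarrow> (S' ^^ n) y \<in> Y"
  by (induction n) auto

lemma iterate_inverse [simp]:
  "y \<in> Y \<Longrightarrow> (S' ^^ n) ((S ^^ n) y) = y" "y \<in> Y \<Longrightarrow> (S ^^ n) ((S' ^^ n) y) = y"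
  by (induction n arbitrary: y) (simp_all add: funpow_swap1)

lemma iterate_inverse_diff:
  assumes "y \<in> Y" "i \<le> n"
  shows "(S ^^ i) ((S' ^^ n) y) = (S' ^^ (n - i)) y" "(S' ^^ i) ((S ^^ n) y) = (S ^^ (n - i)) y"
proof -
  have "(S' ^^ n) y = (S' ^^ i) ((S' ^^ (n - i)) y)" "(S ^^ n) y = (S ^^ i) ((S ^^ (n - i)) y)"
    using assms(2) by (metis funpow_add o_apply le_add_diff_inverse)+
  then show "(S ^^ i) ((S' ^^ n) y) = (S' ^^ (n - i)) y" "(S' ^^ i) ((S ^^ n) y) = (S ^^ (n - i)) y"
    using assms(1) by auto
qed

lemma iterate_inj: "x \<in> Y \<Longrightarrow> y \<in> Y \<Longrightarrow> (S ^^ n) x = (S ^^ n) y \<longleftrightarrow> x = y"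
  by (metis iterate_inverse(1))

lemma iterate_homeomorphism: "homeomorphism Y Y (S ^^ n) (S' ^^ n)"
proof (induction n)
  case 0
  show ?case by (auto simp: homeomorphism_def)
next
  case (Suc n)
  have "homeomorphism Y Y (S \<circ> (S ^^ n)) ((S' ^^ n) \<circ> S')"
    by (rule homeomorphism_compose[OF Suc homeo])
  then show ?case by (simp add: funpow_Suc_right comp_def funpow_swap1 flip: funpow.simps)
qed

lemma continuous_iterate: "continuous_on Y (S ^^ n)" "continuous_on Y (S' ^^ n)"
  using iterate_homeomorphism[of n] by (auto simp: homeomorphism_def)

lemma iterate_image_clopen:
  assumes "openin (top_of_set Y) B" "closedin (top_of_set Y) B"
  shows "openin (top_of_set Y) ((S ^^ n) ` B)" "closedin (top_of_set Y) ((S ^^ n) ` B)"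
  using homeomorphism_imp_open_map[OF iterate_homeomorphism assms(1)]
    homeomorphism_imp_closed_map[OF iterate_homeomorphism assms(2)] by auto

lemma locally_constant_iterate:
  "locally_constant_on Y g \<Longrightarrow> locally_constant_on Y (\<lambda>y. g ((S ^^ n) y))"
  "locally_constant_on Y g \<Longrightarrow> locally_constant_on Y (\<lambda>y. g ((S' ^^ n) y))"
  using continuous_iterate[of n] by (auto intro: locally_constant_on_compose)

lemma inv_into_eq: "y \<in> Y \<Longrightarrow> inv_into Y S y = S' y"
  by (metis inv_into_f_f inj_on_inverseI inverses maps(2))

lemma inv_into_iterate: "y \<in> Y \<Longrightarrow> (inv_into Y S ^^ n) y = (S' ^^ n) y"
  by (induction n) (simp_all add: inv_into_eq)

text \<open>Minimality concerns two-sided orbits. By compactness some \<open>N\<close> bounds the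
  time to a visit, in one direction or the other, from every point; applied to the point
  \<open>N\<close> steps ahead or behind, this gives one-sided visits.\<close>

lemma visits_of_minimal:
  assumes "minimal_system Y S" "openin (top_of_set Y) V" "V \<noteq> {}" "y \<in> Y"
  shows "\<exists>j. (S ^^ j) y \<in> V" "\<exists>j. (S' ^^ j) y \<in> V"
proof -
  have visit: "\<exists>n. (S ^^ n) z \<in> V \<or> (S' ^^ n) z \<in> V" if z: "z \<in> Y" for z
  proof -
    obtain V' where V': "open V'" "V = Y \<inter> V'" using assms(2) by (auto simp: openin_open)
    obtain v where "v \<in> V" using assms(3) by blast
    then have "v \<in> closure (full_orbit Y S z)" "v \<in> V'"
      using assms(1) z V' unfolding minimal_system_def by auto
    then obtain x where x: "x \<in> full_orbit Y S z" "x \<in> V'"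
      using V'(1) by (meson closure_iff_nhds_not_empty disjoint_iff subset_refl)
    then obtain i where "x = int_iterate Y S i z" unfolding full_orbit_def by auto
    then have "x = (S ^^ nat i) z \<or> x = (S' ^^ nat (- i)) z"
      unfolding int_iterate_def using z by (auto simp: inv_into_iterate split: if_splits)
    then show ?thesis using x V' z by (metis IntI iterates)
  qed
  then obtain n where n: "\<And>z. z \<in> Y \<Longrightarrow> (S ^^ n z) z \<in> V \<or> (S' ^^ n z) z \<in> V" by metis
  define K where "K z = (Y \<inter> (S ^^ n z) -` V) \<union> (Y \<inter> (S' ^^ n z) -` V)" for z
  have "openin (top_of_set Y) (K z)" for z
    unfolding K_def using assms(2) continuous_iterate
    by (intro openin_Un continuous_openin_preimage[of _ _ Y]) auto
  moreover have "z \<in> K z" if "z \<in> Y" for z using n[OF that] that by (auto simp: K_def)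
  ultimately obtain D where D: "finite D" "D \<subseteq> Y" "Y \<subseteq> (\<Union>z\<in>D. K z)"
    using compact_finite_subcover[OF compact_space, of K] by metis
  define N where "N = Max (insert 0 (n ` D))"
  have N: "\<exists>i\<le>N. (S ^^ i) z \<in> V \<or> (S' ^^ i) z \<in> V" if "z \<in> Y" for z
  proof -
    obtain x where x: "x \<in> D" "z \<in> K x" using D \<open>z \<in> Y\<close> by blast
    then have "n x \<le> N" using D(1) by (simp add: N_def)
    then show ?thesis using x by (auto simp: K_def)
  qed
  obtain i where "i \<le> N" "(S ^^ i) ((S ^^ N) y) \<in> V \<or> (S' ^^ i) ((S ^^ N) y) \<in> V"
    using N assms(4) iterates by blast
  then show "\<exists>j. (S ^^ j) y \<in> V"
    using iterate_inverse_diff(2)[OF assms(4)] by (metis funpow_add o_apply)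
  obtain i where "i \<le> N" "(S ^^ i) ((S' ^^ N) y) \<in> V \<or> (S' ^^ i) ((S' ^^ N) y) \<in> V"
    using N assms(4) iterates by blast
  then show "\<exists>j. (S' ^^ j) y \<in> V"
    using iterate_inverse_diff(1)[OF assms(4)] by (metis funpow_add o_apply)
qed

text \<open>If the point lay in a level \<open>j > 0\<close>, undoing one \<open>S\<close> would
  make the top level meet level \<open>j - 1\<close>. Disjointness and injectivity then identify the
  towers and force \<open>j = h\<close>, which is not below the height.\<close>

lemma KR_top_level:
  assumes "KR_partition Y S P" "(B, h) \<in> P" "b \<in> B"
  shows "(S ^^ h) b \<in> tower_base P"
proof -
  have h: "0 < h" using assms unfolding KR_partition_def by auto
  have cover: "\<Union> (levels S P) = Y" and disj: "disjoint (levels S P)"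
    using assms(1) unfolding KR_partition_def partition_on_def by auto
  have "(S ^^ 0) ` B \<in> levels S P" using levelI[OF assms(2) h, where T = S] .
  then have b: "b \<in> Y" using cover assms(3) by auto
  then have "(S ^^ h) b \<in> \<Union> (levels S P)" using cover by simp
  then obtain B' h' j where B': "(B', h') \<in> P" "j < h'" "(S ^^ h) b \<in> (S ^^ j) ` B'"
    unfolding levels_def by auto
  then obtain b' where b': "b' \<in> B'" "(S ^^ h) b = (S ^^ j) b'" by auto
  have "(S ^^ 0) ` B' \<in> levels S P" using levelI[OF B'(1), where T = S and j = 0] B'(2) by simp
  then have b'Y: "b' \<in> Y" using cover b' by auto
  show ?thesis
  proof (cases j)
    case 0
    then have "(S ^^ h) b = b'" using b' by simp
    then show ?thesis using b'(1) B'(1) unfolding tower_base_def by force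
  next
    case (Suc i)
    obtain k where k: "h = Suc k" using h by (cases h) auto
    have "S ((S ^^ k) b) = S ((S ^^ i) b')" using b' Suc k by simp
    then have "(S ^^ k) b = (S ^^ i) b'" using b b'Y by (metis inverses(1) iterates(1))
    moreover have "(S ^^ k) ` B \<in> levels S P" "(S ^^ i) ` B' \<in> levels S P"
      using levelI[OF assms(2)] levelI[OF B'(1)] B'(2) Suc k by auto
    ultimately have "(S ^^ k) ` B = (S ^^ i) ` B'"
      using disj assms(3) b'(1) by (metis disjointD IntI empty_iff imageI)
    moreover have "((B, h), k) \<in> (SIGMA p:P. {..<snd p})" "((B', h'), i) \<in> (SIGMA p:P. {..<snd p})"
      using assms(2) B' Suc k by auto
    moreover have "inj_on (\<lambda>((B, h), j). (S ^^ j) ` B) (SIGMA p:P. {..<snd p})"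
      using assms(1) unfolding KR_partition_def by simp
    ultimately have "((B, h), k) = ((B', h'), i)"
      by (intro inj_onD[of "\<lambda>((B, h), j). (S ^^ j) ` B" "SIGMA p:P. {..<snd p}"]) simp_all
    then show ?thesis using B'(2) Suc k by simp
  qed
qed

definition return_time :: "'a set \<Rightarrow> 'a \<Rightarrow> nat" where
  "return_time C y = (LEAST j. 0 < j \<and> (S ^^ j) y \<in> C)"

lemma return_time_least: "0 < j \<Longrightarrow> (S ^^ j) y \<in> C \<Longrightarrow> return_time C y \<le> j"
  unfolding return_time_def by (rule Least_le) simp

end

locale minimal_homeo_system = homeo_system +
  assumes minimal: "minimal_system Y S"
begin

lemma nonempty: "Y \<noteq> {}"
  using minimal unfolding minimal_system_def dynamical_system_def by simp

lemmas visits = visits_of_minimal[OF minimal]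

lemma return_time:
  assumes "openin (top_of_set Y) C" "C \<noteq> {}" "y \<in> Y"
  shows "0 < return_time C y" "(S ^^ return_time C y) y \<in> C"
proof -
  obtain j where "(S ^^ j) (S y) \<in> C" using visits(1)[OF assms(1,2), of "S y"] assms(3) by auto
  then have "0 < Suc j \<and> (S ^^ Suc j) y \<in> C" by (simp add: funpow_swap1)
  then have "0 < return_time C y \<and> (S ^^ return_time C y) y \<in> C"
    unfolding return_time_def by (rule LeastI)
  then show "0 < return_time C y" "(S ^^ return_time C y) y \<in> C" by auto
qed

text \<open>The fibres of \<open>\<kappa>\<close> in \<open>C\<close> serve as bases, with the
  common return times as heights. Each point lies above its most recent visit to \<open>C\<close>,
  and it has no other representation because the return times are first returns.\<close>

lemma return_towers:
  fixes \<kappa> :: "'a \<Rightarrow> 'k"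
  assumes C: "openin (top_of_set Y) C" "closedin (top_of_set Y) C" "C \<noteq> {}"
    and \<kappa>: "locally_constant_on Y \<kappa>" "finite (\<kappa> ` C)"
    and ret: "\<And>y z. y \<in> C \<Longrightarrow> z \<in> C \<Longrightarrow> \<kappa> y = \<kappa> z \<Longrightarrow> return_time C y = return_time C z"
  defines "P \<equiv> (\<lambda>y. ({z \<in> C. \<kappa> z = \<kappa> y}, return_time C y)) ` C"
  shows "KR_partition Y S P" "tower_base P = C" "card P \<le> card (\<kappa> ` C)"
proof -
  have CY: "C \<subseteq> Y" using C(1) openin_imp_subset by blast
  have P_iff: "(B, h) \<in> P \<longleftrightarrow> (\<exists>y\<in>C. B = {z \<in> C. \<kappa> z = \<kappa> y} \<and> h = return_time C y)" for B h
    unfolding P_def by auto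
  \<comment> \<open>A tower depends only on the label of its base points, so the labels bound the
    number of towers.\<close>
  define g where "g k = (let y = (SOME y. y \<in> C \<and> \<kappa> y = k) in ({z \<in> C. \<kappa> z = k}, return_time C y))" for k
  have "({z \<in> C. \<kappa> z = \<kappa> y}, return_time C y) = g (\<kappa> y)" if "y \<in> C" for y
  proof -
    define x where "x = (SOME z. z \<in> C \<and> \<kappa> z = \<kappa> y)"
    have "x \<in> C \<and> \<kappa> x = \<kappa> y"
      unfolding x_def using that by (intro someI[of "\<lambda>z. z \<in> C \<and> \<kappa> z = \<kappa> y" y]) simp
    then have "return_time C x = return_time C y" using ret[of x y] that by simp
    then show ?thesis unfolding g_def Let_def x_def[symmetric] by simp
  qed
  then have Pg: "P = g ` \<kappa> ` C" unfolding P_def image_image by (intro image_cong) auto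
  show card: "card P \<le> card (\<kappa> ` C)" unfolding Pg using \<kappa>(2) by (rule card_image_le)
  have fin: "finite P" unfolding Pg using \<kappa>(2) by simp
  show base: "tower_base P = C" unfolding tower_base_def P_def by auto
  have B_ret: "return_time C b = h" "b \<in> C" if "(B, h) \<in> P" "b \<in> B" for B h b
  proof -
    obtain y where y: "y \<in> C" "B = {z \<in> C. \<kappa> z = \<kappa> y}" "h = return_time C y"
      using \<open>(B, h) \<in> P\<close> P_iff by auto
    then show "b \<in> C" using that by auto
    then show "return_time C b = h" using ret[of b y] y that by auto
  qed
  have same: "((B, h), j) = ((B', h'), j')"
    if P: "(B, h) \<in> P" "(B', h') \<in> P" and j: "j < h" "j' < h'"
      and b: "b \<in> B" "b' \<in> B'" "(S ^^ j) b = (S ^^ j') b'" for B h B' h' j j' b b'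
  proof -
    \<comment> \<open>Otherwise \<open>c\<close> would be a return of \<open>c'\<close> to
      \<open>C\<close> after \<open>i' - i\<close> steps, before its return time.\<close>
    have le: "i' \<le> i" if "i' < return_time C c'" "c' \<in> C" "c \<in> C" "(S ^^ i) c = (S ^^ i') c'" for i i' c c'
    proof (rule ccontr)
      assume "\<not> i' \<le> i"
      then have i: "0 < i' - i" "i \<le> i'" by auto
      have "(S' ^^ i) ((S ^^ i) c) = c" using that(3) CY by auto
      then have "c = (S ^^ (i' - i)) c'"
        using that CY iterate_inverse_diff(2)[of c' i i'] i(2) by auto
      then have "return_time C c' \<le> i' - i" using that(3) i by (intro return_time_least) auto
      then show False using that(1) i by linarith
    qed
    have bC: "b \<in> C" "b' \<in> C" "return_time C b = h" "return_time C b' = h'" using B_ret P b by auto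
    then have "j = j'" using le[of j' b' b j] le[of j b b' j'] j b(3) by auto
    then have "b = b'" using b(3) bC CY iterate_inj by blast
    then have "h = h'" "B = B'" using P b(1,2) bC by (auto simp: P_iff)
    then show ?thesis using \<open>j = j'\<close> by simp
  qed
  have ne: "B \<noteq> {}" "0 < h" "openin (top_of_set Y) B" "closedin (top_of_set Y) B" if "(B, h) \<in> P" for B h
  proof -
    obtain y where y: "y \<in> C" "B = {z \<in> C. \<kappa> z = \<kappa> y}" "h = return_time C y"
      using \<open>(B, h) \<in> P\<close> P_iff by auto
    then show "B \<noteq> {}" "0 < h" using return_time(1)[OF C(1,3)] CY by auto
    have "B = C \<inter> {z \<in> Y. \<kappa> z = \<kappa> y}" using y CY by auto
    then show "openin (top_of_set Y) B" "closedin (top_of_set Y) B"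
      using openin_Int[OF C(1) locally_constant_on_openin[OF \<kappa>(1), of "\<lambda>k. k = \<kappa> y"]]
        closedin_Int[OF C(2) locally_constant_on_closedin[OF \<kappa>(1), of "\<lambda>k. k = \<kappa> y"]] by simp_all
  qed
  have cover: "\<exists>L\<in>levels S P. y \<in> L" if y: "y \<in> Y" for y
  proof -
    \<comment> \<open>Time since the most recent visit to \<open>C\<close>, with \<open>0\<close>
      allowed; a return of \<open>z\<close> by time \<open>j\<close> would give a more recent
      visit.\<close>
    define j where "j = (LEAST j. (S' ^^ j) y \<in> C)"
    define z where "z = (S' ^^ j) y"
    have "\<exists>j. (S' ^^ j) y \<in> C" using visits(2)[OF C(1,3) y] .
    then have z: "z \<in> C" unfolding z_def j_def by (rule LeastI_ex)
    have yz: "y = (S ^^ j) z" using y by (simp add: z_def)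
    have "j < return_time C z"
    proof (rule ccontr)
      assume *: "\<not> j < return_time C z"
      have r: "0 < return_time C z" "(S ^^ return_time C z) z \<in> C"
        using return_time[OF C(1,3)] z CY by auto
      then have "(S' ^^ (j - return_time C z)) y \<in> C"
        using iterate_inverse_diff(1)[OF y, of "return_time C z" j] * by (simp add: z_def)
      then have "j \<le> j - return_time C z" unfolding j_def by (rule Least_le)
      then show False using r * by linarith
    qed
    moreover have "({x \<in> C. \<kappa> x = \<kappa> z}, return_time C z) \<in> P" unfolding P_iff using z by blast
    ultimately have "(S ^^ j) ` {x \<in> C. \<kappa> x = \<kappa> z} \<in> levels S P" by (rule levelI[rotated])
    moreover have "y \<in> (S ^^ j) ` {x \<in> C. \<kappa> x = \<kappa> z}" using z by (intro image_eqI[where x = z] yz) simp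
    ultimately show ?thesis by (rule bexI[rotated])
  qed
  have level: "L \<noteq> {}" "openin (top_of_set Y) L" "closedin (top_of_set Y) L" if "L \<in> levels S P" for L
    using that ne iterate_image_clopen unfolding levels_def by auto
  have "\<Union> (levels S P) = Y"
    using cover level(2) openin_imp_subset by blast
  moreover have "disjoint (levels S P)"
  proof (rule disjointI)
    fix L M assume LM: "L \<in> levels S P" "M \<in> levels S P" "L \<noteq> M"
    obtain B h j where L: "(B, h) \<in> P" "j < h" "L = (S ^^ j) ` B"
      using levelE[OF LM(1)] by blast
    obtain B' h' j' where M: "(B', h') \<in> P" "j' < h'" "M = (S ^^ j') ` B'"
      using levelE[OF LM(2)] by blast
    show "L \<inter> M = {}"
    proof (rule ccontr)
      assume "L \<inter> M \<noteq> {}"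
      then obtain b b' where "b \<in> B" "b' \<in> B'" "(S ^^ j) b = (S ^^ j') b'" unfolding L(3) M(3) by auto
      then have "((B, h), j) = ((B', h'), j')" using same[OF L(1) M(1) L(2) M(2)] by blast
      then show False using LM(3) L(3) M(3) by simp
    qed
  qed
  ultimately have part: "partition_on Y (levels S P)"
    using level(1) by (intro partition_onI) (auto simp: disjoint_def disjnt_def)
  have inj: "inj_on (\<lambda>((B, h), j). (S ^^ j) ` B) (SIGMA p:P. {..<snd p})"
  proof (rule inj_onI, clarsimp)
    fix B h j B' h' j'
    assume *: "(B, h) \<in> P" "j < h" "(B', h') \<in> P" "j' < h'" "(S ^^ j) ` B = (S ^^ j') ` B'"
    obtain b where b: "b \<in> B" using ne(1)[OF *(1)] by blast
    then have "(S ^^ j) b \<in> (S ^^ j') ` B'" using *(5) by blast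
    then obtain b' where b': "b' \<in> B'" "(S ^^ j) b = (S ^^ j') b'" by auto
    have "((B, h), j) = ((B', h'), j')" using same[OF *(1,3,2,4) b b'] .
    then show "B = B' \<and> h = h' \<and> j = j'" by simp
  qed
  show "KR_partition Y S P" unfolding KR_partition_def
    using fin ne(2) part inj level(2,3) by blast
qed

end

section \<open>Dynamics of parsing positions along orbits\<close>

section \<open>Parsing states of a coded minimal system\<close>

text \<open>\<open>factors\<close> asks only for subwords of concatenations: a block may have
  several parsings, and those of different blocks need not fit together.\<close>

locale coded_system = minimal_homeo_system +
  fixes f :: "'a \<Rightarrow> 'c" and W :: "'c list set"
  assumes letters: "locally_constant_on Y f"
    and words: "finite W" "prefix_code W"
    and factors: "\<And>y k. y \<in> Y \<Longrightarrow> \<exists>u\<in>concats W. sublist (itinerary S f k y) u"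
begin

text \<open>The newest letter stands last, so passing to \<open>S y\<close> appends a letter, as in
  \<open>parse_states_snoc\<close>.\<close>

primrec past :: "nat \<Rightarrow> 'a \<Rightarrow> 'c list" where
  "past 0 y = []"
| "past (Suc k) y = past k (S' y) @ [f (S' y)]"

lemma past_eq: "y \<in> Y \<Longrightarrow> past k y = itinerary S f k ((S' ^^ k) y)"
proof (induction k arbitrary: y)
  case (Suc k)
  have "(S' ^^ k) (S' y) = (S' ^^ Suc k) y" by (simp add: funpow_swap1)
  moreover have "(S ^^ k) ((S' ^^ k) (S' y)) = S' y" using Suc.prems by simp
  ultimately show ?case using Suc.IH[of "S' y"] Suc.prems by (simp del: funpow.simps)
qed simp

lemma past_next: "y \<in> Y \<Longrightarrow> past (Suc k) (S y) = past k y @ [f y]"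
  by simp

lemma past_suffix: "k \<le> l \<Longrightarrow> suffix (past k y) (past l y)"
proof (induction l rule: dec_induct)
  case (step l)
  have "suffix (past l y) (past (Suc l) y)" for l y
  proof (induction l arbitrary: y)
    case (Suc l)
    show ?case using Suc[of "S' y"] by (subst (1 2) past.simps) (simp only: snoc_suffix_snoc)
  qed simp
  then show ?case using step.IH suffix_order.trans by blast
qed simp

lemma locally_constant_past: "locally_constant_on Y (past k)"
proof (induction k)
  case 0
  show ?case using locally_constant_on_const[of Y "[]"] by simp
next
  case (Suc k)
  have "locally_constant_on Y (\<lambda>y. past k (S' y) @ [f (S' y)])"
    using locally_constant_iterate(2)[OF Suc, of 1] locally_constant_iterate(2)[OF letters, of 1]
    by (intro locally_constant_on_combine[where F = "\<lambda>p a. p @ [a]"]) simp_all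
  then show ?case by simp
qed

definition state :: "'a \<Rightarrow> 'c list set" where
  "state y = (\<Inter>k. parse_states W (past k y))"

lemma finite_parse_states: "finite (parse_states W p)"
  using finite_nodes[OF words(1)] by (rule finite_subset[rotated]) (auto simp: parse_states_def)

lemma finite_state: "finite (state y)"
  unfolding state_def using finite_parse_states by (meson finite_INT UNIV_I)

text \<open>Longer pasts admit fewer positions; this decreasing chain of finite sets is stationary
  from a stage of least cardinality on.\<close>

lemma state_eventually: "\<exists>k. \<forall>l\<ge>k. state y = parse_states W (past l y)"
proof -
  obtain k where k: "\<And>l. card (parse_states W (past k y)) \<le> card (parse_states W (past l y))"
    using ex_has_least_nat[of "\<lambda>_. True" 0 "\<lambda>k. card (parse_states W (past k y))"] by auto
  have mono: "parse_states W (past l y) \<subseteq> parse_states W (past i y)" if "i \<le> l" for i l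
    using past_suffix[OF that] parse_states_suffix by blast
  have eq: "parse_states W (past l y) = parse_states W (past k y)" if "k \<le> l" for l
    using mono[OF that] k finite_parse_states by (intro card_seteq)
  have "parse_states W (past k y) \<subseteq> parse_states W (past l y)" for l
    using mono[of l k] eq[of l] by (cases "k \<le> l") auto
  then have "state y = parse_states W (past k y)" unfolding state_def by blast
  then show ?thesis using eq by blast
qed

lemma state_nonempty:
  assumes "y \<in> Y"
  shows "state y \<noteq> {}"
proof -
  obtain k where k: "state y = parse_states W (past k y)" using state_eventually[of y] by blast
  \<comment> \<open>A block of length one already exhibits a nonempty word in \<open>W\<close>, as
    \<open>parse_states_nonempty\<close> demands.\<close>
  obtain u where "u \<in> concats W" "sublist [f y] u" using factors[OF assms, of 1] by auto
  then have "f y \<in> set u" using set_mono_sublist by fastforce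
  moreover obtain ws where "ws \<in> lists W" "u = concat ws"
    using \<open>u \<in> concats W\<close> unfolding concats_def by blast
  ultimately obtain w where "w \<in> W" "f y \<in> set w" by (auto simp: in_lists_conv_set)
  then have "W - {[]} \<noteq> {}" by (metis Diff_iff empty_iff list.set(1) singletonD)
  moreover have "\<exists>u\<in>concats W. sublist (past k y) u"
    unfolding past_eq[OF assms] using assms by (intro factors) simp
  ultimately show ?thesis unfolding k using parse_states_nonempty by blast
qed

lemma state_next:
  assumes "y \<in> Y"
  shows "state (S y) = advance W (f y) ` {n \<in> state y. can_read W n (f y)}"
proof -
  obtain k l where kl: "\<And>i. k \<le> i \<Longrightarrow> state y = parse_states W (past i y)"
    "\<And>i. l \<le> i \<Longrightarrow> state (S y) = parse_states W (past i (S y))"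
    using state_eventually by metis
  \<comment> \<open>The past of \<open>S y\<close> is taken one letter longer than that of
    \<open>y\<close>, both beyond the stages where the states have stabilized.\<close>
  have "state (S y) = parse_states W (past (Suc (max k l)) (S y))" by (rule kl(2)) simp
  also have "\<dots> = advance W (f y) ` {n \<in> parse_states W (past (max k l) y). can_read W n (f y)}"
    unfolding past_next[OF assms] by (rule parse_states_snoc[OF words(2)])
  also have "parse_states W (past (max k l) y) = state y" using kl(1)[of "max k l"] by simp
  finally show ?thesis .
qed

lemma card_state_next: "y \<in> Y \<Longrightarrow> card (state (S y)) \<le> card {n \<in> state y. can_read W n (f y)}"
  unfolding state_next using finite_state by (intro card_image_le) simp

lemma card_state_mono: "y \<in> Y \<Longrightarrow> card (state ((S ^^ j) y)) \<le> card (state y)"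
proof (induction j)
  case (Suc j)
  let ?z = "(S ^^ j) y"
  have "card (state (S ?z)) \<le> card {n \<in> state ?z. can_read W n (f ?z)}"
    using Suc.prems by (intro card_state_next) simp
  also have "\<dots> \<le> card (state ?z)" using finite_state by (intro card_mono) auto
  finally show ?case using Suc by simp
qed simp

text \<open>Finitely many past letters determine the state of \<open>y\<close>. A point sharing them
  has no further positions, though its longer past may exclude some.\<close>

lemma state_upper_semicontinuous:
  assumes "y \<in> Y"
  obtains V where "openin (top_of_set Y) V" "y \<in> V" "\<And>z. z \<in> V \<Longrightarrow> state z \<subseteq> state y"
proof -
  obtain k where k: "state y = parse_states W (past k y)" using state_eventually[of y] by blast
  obtain V where V: "openin (top_of_set Y) V" "y \<in> V" "\<And>z. z \<in> V \<Longrightarrow> past k z = past k y"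
    using locally_constant_onD[OF locally_constant_past assms] by blast
  have "state z \<subseteq> state y" if "z \<in> V" for z
  proof -
    have "state z \<subseteq> parse_states W (past k z)" unfolding state_def by blast
    then show ?thesis using V(3)[OF that] k by simp
  qed
  then show ?thesis using V that by blast
qed

text \<open>Let \<open>x\<close> minimise the cardinality. The backward orbit of \<open>y\<close>
  visits a neighbourhood where states are contained in that of \<open>x\<close>, and from there to
  \<open>y\<close> the cardinality cannot increase.\<close>

lemma card_state_constant:
  assumes "y \<in> Y" "z \<in> Y"
  shows "card (state y) = card (state z)"
proof -
  obtain x where x: "x \<in> Y" "\<And>y. y \<in> Y \<Longrightarrow> card (state x) \<le> card (state y)"
    using ex_has_least_nat[of "\<lambda>x. x \<in> Y" z "\<lambda>x. card (state x)"] assms(2) by blast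
  have "card (state y) = card (state x)" if y: "y \<in> Y" for y
  proof -
    obtain V where V: "openin (top_of_set Y) V" "x \<in> V" "\<And>z. z \<in> V \<Longrightarrow> state z \<subseteq> state x"
      using state_upper_semicontinuous[OF x(1)] by blast
    obtain j where j: "(S' ^^ j) y \<in> V" using visits(2)[OF V(1) _ y] V(2) by blast
    have "card (state y) \<le> card (state ((S' ^^ j) y))"
      using card_state_mono[of "(S' ^^ j) y" j] y by simp
    also have "\<dots> \<le> card (state x)" using V(3)[OF j] finite_state by (rule card_mono[rotated])
    finally show ?thesis using x(2)[OF y] by simp
  qed
  then show ?thesis using assms by simp
qed

text \<open>Upper semicontinuity gives an inclusion of finite sets, and equal cardinalities turn it
  into equality.\<close>

lemma locally_constant_state: "locally_constant_on Y state"
  unfolding locally_constant_on_def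
proof
  fix y assume y: "y \<in> Y"
  obtain V where V: "openin (top_of_set Y) V" "y \<in> V" "\<And>z. z \<in> V \<Longrightarrow> state z \<subseteq> state y"
    using state_upper_semicontinuous[OF y] by blast
  have "state z = state y" if "z \<in> V" for z
  proof (rule card_seteq[OF finite_state V(3)[OF that]])
    have "z \<in> Y" using that openin_imp_subset[OF V(1)] by blast
    then show "card (state y) \<le> card (state z)" using card_state_constant[OF y] by simp
  qed
  then show "\<exists>V. openin (top_of_set Y) V \<and> y \<in> V \<and> (\<forall>z\<in>V. state z = state y)"
    using V(1,2) by blast
qed

text \<open>A position unable to read the letter would be lost, lowering the cardinality. Hence one
  non-branching member of the state determines the letter.\<close>

lemma state_can_read:
  assumes "y \<in> Y" "n \<in> state y"
  shows "can_read W n (f y)"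
proof -
  have "card (state y) \<le> card {n \<in> state y. can_read W n (f y)}"
    using card_state_next[OF assms(1)] card_state_constant[of y "S y"] assms(1) by simp
  then have "{n \<in> state y. can_read W n (f y)} = state y"
    using finite_state by (intro card_seteq) auto
  then show ?thesis using assms(2) by blast
qed

lemma state_next': "y \<in> Y \<Longrightarrow> state (S y) = advance W (f y) ` state y"
  using state_next state_can_read by (metis (no_types, lifting) Collect_cong Collect_mem_eq)

end

section \<open>Return towers, counted in terms of the number of words\<close>

section \<open>Partitions with boundedly many towers\<close>

context minimal_homeo_system
begin

text \<open>The bound is independent of \<open>q\<close>: \<open>2 ^ d\<^sup>2 + 1\<close> bounds
  the number of states allowed in the base, and \<open>d\<close> the letters possible at each.
  Codings are list-valued because a letter is the block of \<open>q\<close>-values up to the next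
  visit to the fibre of \<open>u\<close>.\<close>

lemma KR_partition_of_words:
  fixes q :: "'a \<Rightarrow> 'c"
  assumes q: "locally_constant_on Y q" and u: "u \<in> Y"
    and words: "\<And>f :: 'a \<Rightarrow> 'c list. locally_constant_on Y f \<Longrightarrow>
      \<exists>W. finite W \<and> card W \<le> d \<and> [] \<notin> W \<and>
        (\<forall>y\<in>Y. \<forall>k. \<exists>v\<in>concats W. sublist (itinerary S f k y) v)"
  shows "\<exists>P. KR_partition Y S P \<and> card P \<le> (2 ^ d\<^sup>2 + 1) * d \<and>
    tower_base P \<subseteq> {y \<in> Y. q y = q u} \<and> (\<forall>L\<in>levels S P. \<forall>x\<in>L. \<forall>y\<in>L. q x = q y)"
proof -
  define U where "U = {y \<in> Y. q y = q u}"
  have U: "openin (top_of_set Y) U" "U \<noteq> {}"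
    unfolding U_def using locally_constant_on_openin[OF q] u by auto
  define r where "r y = return_time U y" for y
  define f where "f y = map (\<lambda>j. q ((S ^^ j) y)) [0..<r y]" for y
  have r: "0 < r y" "(S ^^ r y) y \<in> U" if "y \<in> Y" for y
    unfolding r_def using return_time[OF U that] by auto
  have r_le: "r y \<le> j" if "0 < j" "(S ^^ j) y \<in> U" for y j
    unfolding r_def using return_time_least that .
  have q_f: "q y = hd (f y)" if "y \<in> Y" for y
    unfolding f_def using r(1)[OF that] by (simp add: upt_conv_Cons)
  have next_U: "S y \<in> U \<longleftrightarrow> length (f y) = 1" if "y \<in> Y" for y
  proof -
    have "S y \<in> U \<longleftrightarrow> r y = 1"
      using r[OF that] r_le[of 1 y] by auto
    then show ?thesis by (simp add: f_def)
  qed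
  \<comment> \<open>Away from \<open>U\<close> the next letter is forced: the old one without its
    first entry.\<close>
  have next_f: "f (S y) = tl (f y)" if y: "y \<in> Y" "S y \<notin> U" for y
  proof -
    have "r y \<noteq> 1" using next_U[OF y(1)] y(2) by (simp add: f_def)
    then obtain i where i: "r y = Suc i" "0 < i" using r(1)[OF y(1)] by (cases "r y") auto
    have "(S ^^ i) (S y) \<in> U" using r(2)[OF y(1)] i by (simp add: funpow_swap1)
    then have "r (S y) \<le> i" using r_le i(2) by blast
    moreover have "(S ^^ Suc (r (S y))) y \<in> U" using r(2)[of "S y"] y(1) by (simp add: funpow_swap1)
    then have "Suc i \<le> Suc (r (S y))" using r_le i(1) by (metis zero_less_Suc)
    ultimately have "r (S y) = i" by simp
    then show ?thesis unfolding f_def i(1)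
      by (simp add: upt_conv_Cons map_Suc_upt[symmetric] funpow_swap1 comp_def del: upt_Suc)
  qed
  have f: "locally_constant_on Y f"
  proof (rule locally_constant_on_of_coarser)
    fix y assume y: "y \<in> Y"
    \<comment> \<open>One value more than in \<open>f y\<close>: the entry at time
      \<open>r y\<close> detects the visit to \<open>U\<close>, which is a fibre of
      \<open>q\<close>.\<close>
    define h where "h z = map (\<lambda>j. q ((S ^^ j) z)) [0..<Suc (r y)]" for z
    have "locally_constant_on Y h"
      unfolding h_def by (intro locally_constant_on_map locally_constant_iterate q)
    moreover have "f z = f y" if z: "z \<in> Y" "h z = h y" for z
    proof -
      have eq: "q ((S ^^ j) z) = q ((S ^^ j) y)" if "j \<le> r y" for j
        using z(2) that unfolding h_def by (metis atLeastLessThan_iff le_imp_less_Suc map_eq_conv set_upt zero_le)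
      then have U_eq: "(S ^^ j) z \<in> U \<longleftrightarrow> (S ^^ j) y \<in> U" if "j \<le> r y" for j
        using y z that by (simp add: U_def)
      have "r z \<le> r y" using r_le[of "r y" z] U_eq r[OF y] by simp
      moreover have "r y \<le> r z" using r_le[of "r z" y] U_eq r[OF z(1)] calculation by simp
      ultimately show ?thesis unfolding f_def using eq by simp
    qed
    ultimately show "\<exists>h. locally_constant_on Y (h :: _ \<Rightarrow> 'c list) \<and> (\<forall>z\<in>Y. h z = h y \<longrightarrow> f z = f y)"
      by blast
  qed
  obtain W0 where W0: "finite W0" "card W0 \<le> d" "[] \<notin> W0"
    "\<And>y k. y \<in> Y \<Longrightarrow> \<exists>v\<in>concats W0. sublist (itinerary S f k y) v"
    using words[OF f] by blast
  obtain W where W: "finite W" "card W \<le> card W0" "prefix_code W" "concats W0 \<subseteq> concats W"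
    using exists_prefix_code[OF W0(1,3)] by blast
  interpret coded_system Y S S' f W
    by unfold_locales (use f W W0(4) in blast)+
  \<comment> \<open>Only states made of branching nodes can leave the letter open;
    \<open>state u\<close> is added so that \<open>C\<close> contains \<open>u\<close>.\<close>
  define \<Sigma> where "\<Sigma> = insert (state u) (Pow (branching W))"
  define C where "C = {y \<in> Y. (q y = q u \<and> state y \<in> \<Sigma>)}"
  define \<kappa> where "\<kappa> y = (state y, f y)" for y
  have C_lc: "locally_constant_on Y (\<lambda>y. q y = q u \<and> state y \<in> \<Sigma>)"
    using q locally_constant_state
    by (rule locally_constant_on_combine[where F = "\<lambda>a s. a = q u \<and> s \<in> \<Sigma>"])
  have C: "openin (top_of_set Y) C" "closedin (top_of_set Y) C" "C \<noteq> {}"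
    unfolding C_def using locally_constant_on_openin[OF C_lc, of "\<lambda>b. b"]
      locally_constant_on_closedin[OF C_lc, of "\<lambda>b. b"] u by (auto simp: \<Sigma>_def)
  have CY: "C \<subseteq> Y" by (auto simp: C_def)
  have \<kappa>_lc: "locally_constant_on Y \<kappa>"
    unfolding \<kappa>_def by (rule locally_constant_on_combine[OF locally_constant_state f])
  have next_C: "S y \<in> C \<longleftrightarrow> S z \<in> C" if "y \<in> Y" "z \<in> Y" "\<kappa> y = \<kappa> z" for y z
  proof -
    have "state (S y) = state (S z)" "S y \<in> U \<longleftrightarrow> S z \<in> U"
      using that state_next' next_U by (auto simp: \<kappa>_def)
    then show ?thesis using that by (auto simp: C_def U_def)
  qed
  \<comment> \<open>Outside \<open>C\<close>, either \<open>S y\<close> is not in \<open>U\<close>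
    and the letter is a tail, or its state has a non-branching node, which reads only one
    letter.\<close>
  have next_\<kappa>: "\<kappa> (S y) = \<kappa> (S z)" if yz: "y \<in> Y" "z \<in> Y" "\<kappa> y = \<kappa> z" "S y \<notin> C" for y z
  proof -
    have st: "state (S y) = state (S z)" and Uyz: "S y \<in> U \<longleftrightarrow> S z \<in> U"
      using yz state_next' next_U by (auto simp: \<kappa>_def)
    have "f (S y) = f (S z)"
    proof (cases "S y \<in> U")
      case False
      then have "f (S y) = tl (f y)" "f (S z) = tl (f z)" using next_f yz Uyz by auto
      then show ?thesis using yz(3) by (simp add: \<kappa>_def)
    next
      case True
      then have "state (S y) \<notin> \<Sigma>" using yz(4) by (auto simp: C_def U_def)
      then obtain n where n: "n \<in> state (S y)" "n \<notin> branching W" by (auto simp: \<Sigma>_def)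
      have "can_read W n (f (S y))" "can_read W n (f (S z))"
        using n(1) st state_can_read yz by auto
      then show ?thesis using n(2) by (auto simp: branching_def)
    qed
    then show ?thesis using st by (simp add: \<kappa>_def)
  qed
  have path: "\<kappa> ((S ^^ j) y) = \<kappa> ((S ^^ j) z)"
    if "y \<in> Y" "z \<in> Y" "\<kappa> y = \<kappa> z" "j < return_time C y" for y z j
    using that(4)
  proof (induction j)
    case 0
    then show ?case using that by simp
  next
    case (Suc j)
    have "S ((S ^^ j) y) \<notin> C"
      using return_time_least[of "Suc j" y C] Suc.prems by auto
    then show ?case using next_\<kappa>[of "(S ^^ j) y" "(S ^^ j) z"] Suc that by simp
  qed
  \<comment> \<open>Equal labels persist until the first return of \<open>y\<close>, and
    \<open>next_C\<close> then brings \<open>z\<close> into \<open>C\<close> as well; symmetry gives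
    equality.\<close>
  have ret_le: "return_time C z \<le> return_time C y" if "y \<in> Y" "z \<in> Y" "\<kappa> y = \<kappa> z" for y z
  proof -
    have ret: "0 < return_time C y" "(S ^^ return_time C y) y \<in> C"
      using return_time[OF C(1,3) that(1)] by auto
    then obtain j where j: "return_time C y = Suc j" by (cases "return_time C y") auto
    have "(S ^^ Suc j) z \<in> C"
      using next_C[of "(S ^^ j) y" "(S ^^ j) z"] path[OF that, of j] ret(2) j that by simp
    then show ?thesis unfolding j by (intro return_time_least) auto
  qed
  then have ret: "return_time C y = return_time C z" if "y \<in> C" "z \<in> C" "\<kappa> y = \<kappa> z" for y z
    using that CY by (metis antisym subsetD)
  \<comment> \<open>One position is chosen in each state; all letters occurring with that state are
    readable there, so there are at most \<open>d\<close>.\<close>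
  define A where "A s = {a. can_read W (SOME n. n \<in> s) a}" for s
  have sub: "\<kappa> ` C \<subseteq> Sigma \<Sigma> A"
  proof (rule image_subsetI)
    fix y assume y: "y \<in> C"
    then have "state y \<noteq> {}" using state_nonempty CY by auto
    then have "(SOME n. n \<in> state y) \<in> state y" by (simp add: some_in_eq)
    then have "can_read W (SOME n. n \<in> state y) (f y)" using state_can_read y CY by blast
    then show "\<kappa> y \<in> Sigma \<Sigma> A" using y by (auto simp: \<kappa>_def A_def C_def)
  qed
  have fin\<Sigma>: "finite \<Sigma>" unfolding \<Sigma>_def using card_branching(1)[OF W(1)] by simp
  have A: "finite (A s)" "card (A s) \<le> d" for s
    unfolding A_def using card_can_read[OF W(1), of "SOME n. n \<in> s"] W(2) W0(2) by linarith+
  have finS: "finite (Sigma \<Sigma> A)" using fin\<Sigma> A(1) by (intro finite_SigmaI) auto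
  have fin\<kappa>: "finite (\<kappa> ` C)" using finite_subset[OF sub finS] .
  have "card (\<kappa> ` C) \<le> card (Sigma \<Sigma> A)" using card_mono[OF finS sub] .
  also have "card (Sigma \<Sigma> A) = (\<Sum>s\<in>\<Sigma>. card (A s))" using fin\<Sigma> A(1) by (simp add: card_SigmaI)
  also have "\<dots> \<le> card \<Sigma> * d" using sum_bounded_above[of \<Sigma> "\<lambda>s. card (A s)" d] A(2) by simp
  also have "card \<Sigma> \<le> 2 ^ d\<^sup>2 + 1"
  proof -
    have "card W \<le> d" using W(2) W0(2) by simp
    then have "card (branching W) \<le> d\<^sup>2"
      using card_branching(2)[OF W(1)] by (meson le_trans power_mono zero_le)
    then have "card (Pow (branching W)) \<le> 2 ^ d\<^sup>2"
      using card_branching(1)[OF W(1)] by (simp add: card_Pow)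
    then show ?thesis unfolding \<Sigma>_def
      using card_insert_le_m1[of "2 ^ d\<^sup>2 + 1" "Pow (branching W)" "state u"] by simp
  qed
  finally have card: "card (\<kappa> ` C) \<le> (2 ^ d\<^sup>2 + 1) * d" by simp
  define P where "P = (\<lambda>y. ({z \<in> C. \<kappa> z = \<kappa> y}, return_time C y)) ` C"
  have P: "KR_partition Y S P" "tower_base P = C" "card P \<le> card (\<kappa> ` C)"
    unfolding P_def using return_towers[OF C \<kappa>_lc fin\<kappa> ret] by blast+
  have const: "q x = q y" if L: "L \<in> levels S P" and xy: "x \<in> L" "y \<in> L" for L x y
  proof -
    obtain B h j where Bhj: "(B, h) \<in> P" "j < h" "L = (S ^^ j) ` B" using levelE[OF L] by blast
    then obtain z where z: "z \<in> C" "B = {x \<in> C. \<kappa> x = \<kappa> z}" "h = return_time C z"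
      unfolding P_def by auto
    \<comment> \<open>The label is constant along a level, and the first entry of its letter is the
      value of \<open>q\<close>.\<close>
    have hd_z: "q ((S ^^ j) b) = hd (f ((S ^^ j) z))" if "b \<in> B" for b
    proof -
      have b: "b \<in> Y" "z \<in> Y" "\<kappa> z = \<kappa> b" using that z(1,2) CY by auto
      have "\<kappa> ((S ^^ j) z) = \<kappa> ((S ^^ j) b)"
        using path[OF b(2,1,3)] Bhj(2) z(3) by blast
      then have "f ((S ^^ j) z) = f ((S ^^ j) b)" unfolding \<kappa>_def by (rule Pair_inject)
      then show ?thesis using q_f[of "(S ^^ j) b"] b(1) by simp
    qed
    obtain b c where "b \<in> B" "c \<in> B" "x = (S ^^ j) b" "y = (S ^^ j) c" using xy Bhj(3) by blast
    then show ?thesis using hd_z by simp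
  qed
  have "tower_base P \<subseteq> {y \<in> Y. q y = q u}" unfolding P(2) by (auto simp: C_def)
  moreover have "card P \<le> (2 ^ d\<^sup>2 + 1) * d" using P(3) card by (rule le_trans)
  ultimately show ?thesis using P(1) const by blast
qed

end

section \<open>Itineraries as subwords of concatenated tower words\<close>

section \<open>Words from the towers of a realization\<close>

lemma realization_refines:
  assumes "realization X T P" "n \<le> m"
  shows "refines X (levels T (P m)) (levels T (P n))"
  using assms(2)
proof (induction m rule: dec_induct)
  case base
  show ?case using assms(1) by (auto simp: realization_def KR_partition_def intro: refines_refl)
next
  case (step m)
  then show ?case using assms(1) by (auto simp: realization_def intro: refines_trans)
qed

text \<open>The levels are given as a subbasis; as the partitions are nested, a level of the later
  partition lies inside both of two levels around a point, so they form a basis.\<close>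

lemma realization_neighbourhood:
  assumes P: "realization X T P" and V: "openin (top_of_set X) V" "x \<in> V"
  shows "\<exists>n. \<exists>L\<in>levels T (P n). x \<in> L \<and> L \<subseteq> V"
proof -
  have part: "partition_on X (levels T (P n))" for n
    using P unfolding realization_def KR_partition_def by blast
  have finer: "M \<subseteq> L" if "n \<le> m" "M \<in> levels T (P m)" "L \<in> levels T (P n)" "x \<in> M" "x \<in> L" for n m L M x
  proof -
    obtain L' where L': "L' \<in> levels T (P n)" "M \<subseteq> L'"
      using realization_refines[OF P \<open>n \<le> m\<close>] \<open>M \<in> levels T (P m)\<close> unfolding refines_def by blast
    have "L' = L"
      using disjointD[OF partition_onD2[OF part[of n]] L'(1) \<open>L \<in> levels T (P n)\<close>] L'(2)
        \<open>x \<in> M\<close> \<open>x \<in> L\<close> by blast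
    then show ?thesis using L' by simp
  qed
  have "generate_topology_on (\<Union>n. levels T (P n)) V"
    using P V(1) unfolding realization_def by (metis openin_topology_generated_by)
  then show ?thesis using V(2)
  proof (induction arbitrary: x rule: generate_topology_on.induct)
    case (Int A B)
    obtain n L where L: "L \<in> levels T (P n)" "x \<in> L" "L \<subseteq> A" using Int.IH(1) Int.prems by blast
    obtain m M where M: "M \<in> levels T (P m)" "x \<in> M" "M \<subseteq> B" using Int.IH(2) Int.prems by blast
    have "x \<in> X" using L part[of n] partition_onD1 by blast
    then obtain N where N: "N \<in> levels T (P (max n m))" "x \<in> N"
      using partition_onD1[OF part[of "max n m"]] by blast
    have "N \<subseteq> L" "N \<subseteq> M" using finer[OF _ N(1) L(1) N(2) L(2)] finer[OF _ N(1) M(1) N(2) M(2)] by simp_all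
    then show ?case using N L(3) M(3) by blast
  next
    case (UN K)
    then obtain A where A: "A \<in> K" "x \<in> A" by blast
    then obtain n L where "L \<in> levels T (P n)" "x \<in> L" "L \<subseteq> A" using UN.IH by blast
    then show ?case using A(1) by blast
  next
    case (Basis A)
    then show ?case by blast
  qed simp
qed

text \<open>Finitely many levels on which \<open>g\<close> is constant cover \<open>X\<close>; a
  stage refining all of theirs works.\<close>

lemma realization_constant_on_levels:
  assumes X: "compact X" and P: "realization X T P" and g: "locally_constant_on X g"
  shows "\<exists>n. \<forall>L\<in>levels T (P n). \<forall>x\<in>L. \<forall>y\<in>L. g x = g y"
proof -
  have part: "partition_on X (levels T (P n))"
    and op: "L \<in> levels T (P n) \<Longrightarrow> openin (top_of_set X) L" for n L
    using P unfolding realization_def KR_partition_def by blast+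
  have "\<exists>n. \<exists>L\<in>levels T (P n). x \<in> L \<and> (\<forall>y\<in>L. g y = g x)" if x: "x \<in> X" for x
  proof -
    obtain V where V: "openin (top_of_set X) V" "x \<in> V" "\<And>z. z \<in> V \<Longrightarrow> g z = g x"
      using locally_constant_onD[OF g x] by blast
    then obtain n L where "L \<in> levels T (P n)" "x \<in> L" "L \<subseteq> V"
      using realization_neighbourhood[OF P V(1,2)] by blast
    then show ?thesis using V(3) by blast
  qed
  then obtain n L where nL: "\<And>x. x \<in> X \<Longrightarrow> L x \<in> levels T (P (n x)) \<and> x \<in> L x \<and> (\<forall>y\<in>L x. g y = g x)"
    by metis
  then obtain D where D: "finite D" "D \<subseteq> X" "X \<subseteq> (\<Union>x\<in>D. L x)"
    using compact_finite_subcover[of X L] X op by metis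
  define N where "N = Max (insert 0 (n ` D))"
  have "g x = g y" if M: "M \<in> levels T (P N)" "x \<in> M" "y \<in> M" for M x y
  proof -
    have "x \<in> X" using M(1,2) partition_onD1[OF part[of N]] by blast
    then obtain z where z: "z \<in> D" "x \<in> L z" using D(3) by blast
    then have "n z \<le> N" using D(1) by (simp add: N_def)
    then obtain L' where L': "L' \<in> levels T (P (n z))" "M \<subseteq> L'"
      using realization_refines[OF P] M(1) unfolding refines_def by blast
    have Lz: "L z \<in> levels T (P (n z))" "\<forall>y\<in>L z. g y = g z" using nL z(1) D(2) by blast+
    have "L' = L z" using disjointD[OF partition_onD2[OF part[of "n z"]] L'(1) Lz(1)] L'(2) z(2) M(2) by blast
    then have "g x = g z" "g y = g z" using Lz(2) L'(2) M(2,3) by blast+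
    then show ?thesis by simp
  qed
  then show ?thesis by blast
qed

text \<open>Each tower contributes the itinerary from bottom to top. An orbit starting in the base
  climbs tower after tower, since \<open>KR_top_level\<close> returns it to the base.\<close>

lemma (in homeo_system) tower_words:
  assumes P: "KR_partition Y S P" and g: "\<And>L x y. L \<in> levels S P \<Longrightarrow> x \<in> L \<Longrightarrow> y \<in> L \<Longrightarrow> g x = g y"
  shows "\<exists>W. finite W \<and> card W \<le> card P \<and> [] \<notin> W \<and>
    (\<forall>y\<in>Y. \<forall>k. \<exists>v\<in>concats W. sublist (itinerary S g k y) v)"
proof -
  define w where "w B h = itinerary S g h (SOME b. b \<in> B)" for B h
  define W where "W = (\<lambda>(B, h). w B h) ` P"
  have fin: "finite P" and pos: "\<And>B h. (B, h) \<in> P \<Longrightarrow> 0 < h" and part: "partition_on Y (levels S P)"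
    using P unfolding KR_partition_def by auto
  have tower: "itinerary S g h b \<in> W" if "(B, h) \<in> P" "b \<in> B" for B h b
  proof -
    have "(SOME b. b \<in> B) \<in> B" using that(2) by (rule someI)
    then have "g ((S ^^ j) b) = g ((S ^^ j) (SOME b. b \<in> B))" if "j < h" for j
      using g[OF levelI[OF \<open>(B, h) \<in> P\<close> that]] \<open>b \<in> B\<close> by blast
    then have "itinerary S g h b = w B h" unfolding w_def by simp
    then show ?thesis unfolding W_def using that(1) by force
  qed
  have base: "\<exists>v\<in>concats W. prefix (itinerary S g k b) v" if "b \<in> tower_base P" for b k
    using that
  proof (induction k arbitrary: b rule: less_induct)
    case (less k)
    obtain B h where B: "(B, h) \<in> P" "b \<in> B" using less.prems unfolding tower_base_def by auto
    note word = concats_word[OF tower[OF B]]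
    show ?case
    proof (cases "k \<le> h")
      case True
      then obtain i where "h = k + i" by (auto simp: le_iff_add)
      then have "prefix (itinerary S g k b) (itinerary S g h b)"
        using itinerary_add[where T = S and g = g and m = k and k = i and x = b] by (metis prefixI)
      then show ?thesis using word by blast
    next
      case False
      then obtain i where i: "k = h + i" by (metis le_iff_add nat_le_linear)
      then have "i < k" using pos[OF B(1)] by simp
      then obtain v where "v \<in> concats W" "prefix (itinerary S g i ((S ^^ h) b)) v"
        using less.IH KR_top_level[OF P B] by blast
      then have "itinerary S g h b @ v \<in> concats W" "prefix (itinerary S g k b) (itinerary S g h b @ v)"
        using concats_append[OF word] unfolding i itinerary_add by auto
      then show ?thesis by blast
    qed
  qed
  have "\<exists>v\<in>concats W. sublist (itinerary S g k y) v" if y: "y \<in> Y" for y k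
  proof -
    obtain L where L: "L \<in> levels S P" "y \<in> L" using y partition_onD1[OF part] by blast
    obtain B h j where B: "(B, h) \<in> P" "L = (S ^^ j) ` B" by (rule levelE[OF L(1)])
    obtain b where "b \<in> B" and y_eq: "y = (S ^^ j) b" using L(2) unfolding B(2) by (rule imageE)
    have b: "b \<in> tower_base P" unfolding tower_base_def using B(1) \<open>b \<in> B\<close> by force
    \<comment> \<open>Start \<open>j\<close> steps earlier, in the base, and then drop the first
      \<open>j\<close> letters.\<close>
    obtain v where v: "v \<in> concats W" "prefix (itinerary S g (j + k) b) v" using base[OF b] by blast
    have "sublist (itinerary S g k y) (itinerary S g (j + k) b)"
      unfolding itinerary_add y_eq by (rule sublist_append_leftI)
    then have "sublist (itinerary S g k y) v"
      using prefix_imp_sublist[OF v(2)] by (rule sublist_order.order.trans)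
    then show ?thesis using v(1) by blast
  qed
  moreover have "finite W" "card W \<le> card P" unfolding W_def using fin by (auto intro: card_image_le)
  moreover have "[] \<notin> W" unfolding W_def w_def using pos by fastforce
  ultimately show ?thesis by blast
qed

section \<open>Nested partitions with shrinking diameters, and the passage to the factor\<close>

section \<open>Constructing a realization\<close>

context minimal_homeo_system
begin

lemma tower_base_nonempty:
  assumes "KR_partition Y S P"
  shows "tower_base P \<noteq> {}"
proof -
  have part: "partition_on Y (levels S P)" using assms unfolding KR_partition_def by blast
  obtain L where L: "L \<in> levels S P" using nonempty partition_onD1[OF part] by blast
  then have "L \<noteq> {}" using partition_onD3[OF part] by auto
  moreover obtain B h j where "(B, h) \<in> P" "L = (S ^^ j) ` B" by (rule levelE[OF L])
  ultimately show ?thesis unfolding tower_base_def by force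
qed

lemma finite_levels: "finite P \<Longrightarrow> finite (levels S P)"
proof -
  assume "finite P"
  then have "finite ((\<lambda>((B, h), j). (S ^^ j) ` B) ` (SIGMA p:P. {..<snd p}))" by blast
  moreover have "levels S P \<subseteq> (\<lambda>((B, h), j). (S ^^ j) ` B) ` (SIGMA p:P. {..<snd p})"
    by (force simp: levels_def)
  ultimately show ?thesis by (rule finite_subset[rotated])
qed

lemma tower_base_clopen:
  assumes "KR_partition Y S P"
  shows "closedin (top_of_set Y) (tower_base P)" "tower_base P \<subseteq> Y"
proof -
  have "closedin (top_of_set Y) B" if "B \<in> fst ` P" for B
  proof -
    obtain h where h: "(B, h) \<in> P" using \<open>B \<in> fst ` P\<close> by auto
    then have "0 < h" using assms unfolding KR_partition_def by auto
    then have "B \<in> levels S P" using levelI[OF h, where T = S and j = 0] by simp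
    then show ?thesis using assms unfolding KR_partition_def by blast
  qed
  moreover have "finite (fst ` P)" using assms unfolding KR_partition_def by simp
  ultimately show "closedin (top_of_set Y) (tower_base P)"
    unfolding tower_base_def by (intro closedin_Union) auto
  then show "tower_base P \<subseteq> Y" using closedin_imp_subset by blast
qed

text \<open>Nested nonempty closed bases of shrinking diameter meet in one point, and small levels
  fit into any neighbourhood, so they generate the topology.\<close>

lemma realization_of_small_partitions:
  assumes P: "\<And>n. KR_partition Y S (P n)"
    and refines: "\<And>n. refines Y (levels S (P (Suc n))) (levels S (P n))"
    and base: "\<And>n. tower_base (P (Suc n)) \<subseteq> tower_base (P n)"
    and small: "\<And>n x y. x \<in> tower_base (P n) \<Longrightarrow> y \<in> tower_base (P n) \<Longrightarrow> dist x y < inverse (Suc n)"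
      "\<And>n L x y. L \<in> levels S (P n) \<Longrightarrow> x \<in> L \<Longrightarrow> y \<in> L \<Longrightarrow> dist x y < inverse (Suc n)"
  shows "realization Y S P"
proof -
  have part: "partition_on Y (levels S (P n))"
    and op: "\<And>L. L \<in> levels S (P n) \<Longrightarrow> openin (top_of_set Y) L" for n
    using P[of n] unfolding KR_partition_def by blast+
  have "(\<Inter>n. tower_base (P n)) \<noteq> {}"
  proof (rule compact_space_imp_nest)
    show "compact_space (top_of_set Y)" using compact_space by (simp add: compact_space_subtopology)
    show "decseq (\<lambda>n. tower_base (P n))" using base by (rule decseq_SucI)
  qed (use P tower_base_nonempty tower_base_clopen in auto)
  then obtain x where x: "\<And>n. x \<in> tower_base (P n)" by blast
  have "y = x" if y: "\<And>n. y \<in> tower_base (P n)" for y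
  proof (rule ccontr)
    assume "y \<noteq> x"
    then obtain n where "inverse (real (Suc n)) < dist y x"
      using reals_Archimedean[of "dist y x"] by auto
    then show False using small(1)[OF y x, of n] by simp
  qed
  then have "(\<Inter>n. tower_base (P n)) = {x}" using x by blast
  moreover have "topology_generated_by (\<Union>n. levels S (P n)) = top_of_set Y"
    unfolding topology_eq
  proof (intro allI iffI)
    fix V assume "openin (topology_generated_by (\<Union>n. levels S (P n))) V"
    then have "generate_topology_on (\<Union>n. levels S (P n)) V" by (rule openin_topology_generated_by)
    then show "openin (top_of_set Y) V"
      by (rule generate_topology_on_coarsest[rotated 2]) (use op in \<open>auto simp: istopology_openin\<close>)
  next
    fix V assume V: "openin (top_of_set Y) V"
    show "openin (topology_generated_by (\<Union>n. levels S (P n))) V"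
    proof (subst openin_subopen, intro ballI)
      fix y assume y: "y \<in> V"
      then obtain e where e: "0 < e" "ball y e \<inter> Y \<subseteq> V" using V by (metis openin_contains_ball)
      obtain n where n: "inverse (real (Suc n)) < e" using reals_Archimedean[OF e(1)] by blast
      have "y \<in> Y" using y openin_imp_subset[OF V] by blast
      then obtain L where L: "L \<in> levels S (P n)" "y \<in> L" using partition_onD1[OF part[of n]] by blast
      have "L \<subseteq> ball y e" using small(2)[OF L] n by fastforce
      moreover have "L \<subseteq> Y" using L(1) partition_onD1[OF part[of n]] by blast
      ultimately have "L \<subseteq> V" using e(2) by blast
      moreover have "openin (topology_generated_by (\<Union>n. levels S (P n))) L"
        using L(1) by (intro topology_generated_by_Basis) blast
      ultimately show "\<exists>T. openin (topology_generated_by (\<Union>n. levels S (P n))) T \<and> y \<in> T \<and> T \<subseteq> V"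
        using L(2) by blast
    qed
  qed
  ultimately show ?thesis unfolding realization_def using P refines base by blast
qed

text \<open>As \<open>K\<close> does not depend on \<open>q\<close>, partitions can be refined again
  and again without raising the bound on the number of towers.\<close>

lemma finite_topological_rankI:
  assumes Y: "totally_disconnected Y"
    and K: "\<And>(q :: 'a \<Rightarrow> 'a set set \<times> 'a set set) u. locally_constant_on Y q \<Longrightarrow> u \<in> Y \<Longrightarrow>
      \<exists>P. KR_partition Y S P \<and> card P \<le> K \<and> tower_base P \<subseteq> {y \<in> Y. q y = q u} \<and>
        (\<forall>L\<in>levels S P. \<forall>x\<in>L. \<forall>y\<in>L. q x = q y)"
  shows "finite_topological_rank Y S"
proof -
  define good where "good n P \<longleftrightarrow> KR_partition Y S P \<and> card P \<le> K \<and>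
      (\<forall>x\<in>tower_base P. \<forall>y\<in>tower_base P. dist x y < inverse (Suc n)) \<and>
      (\<forall>L\<in>levels S P. \<forall>x\<in>L. \<forall>y\<in>L. dist x y < inverse (Suc n))" for n :: nat and P :: "'a towers"
  define finer where "finer P P' \<longleftrightarrow> refines Y (levels S P') (levels S P) \<and> tower_base P' \<subseteq> tower_base P"
    for P P' :: "'a towers"
  have step: "\<exists>P'. good n P' \<and> (\<forall>x\<in>tower_base P'. \<forall>L\<in>F. u \<in> L \<longrightarrow> x \<in> L) \<and>
      (\<forall>L'\<in>levels S P'. \<forall>L\<in>F. L' \<inter> L \<noteq> {} \<longrightarrow> L' \<subseteq> L)"
    if F: "finite F" "\<And>L. L \<in> F \<Longrightarrow> openin (top_of_set Y) L" "\<And>L. L \<in> F \<Longrightarrow> closedin (top_of_set Y) L"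
      and u: "u \<in> Y" for n F u
  proof -
    obtain p :: "'a \<Rightarrow> 'a set set" where p: "locally_constant_on Y p"
      "\<And>y z. y \<in> Y \<Longrightarrow> z \<in> Y \<Longrightarrow> p y = p z \<Longrightarrow> dist y z < inverse (Suc n)"
      using small_locally_constant[OF compact_space Y, of "inverse (Suc n)"] by auto
    \<comment> \<open>The first component makes the levels respect \<open>F\<close> and puts the
      base into the members of \<open>F\<close> containing \<open>u\<close>; the second controls
      diameters.\<close>
    define q where "q y = ({L \<in> F. y \<in> L}, p y)" for y
    have "locally_constant_on Y q"
      unfolding q_def using locally_constant_on_members[OF F] p(1) by (rule locally_constant_on_combine)
    then obtain P where P: "KR_partition Y S P" "card P \<le> K" "tower_base P \<subseteq> {y \<in> Y. q y = q u}"
      and const: "\<forall>L\<in>levels S P. \<forall>x\<in>L. \<forall>y\<in>L. q x = q y" using K[OF _ u] by blast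
    have LY: "L \<subseteq> Y" if "L \<in> levels S P" for L
      using that P(1) unfolding KR_partition_def partition_on_def by blast
    have "dist x y < inverse (Suc n)" if "x \<in> tower_base P" "y \<in> tower_base P" for x y
    proof -
      have "x \<in> Y" "y \<in> Y" "q x = q u" "q y = q u" using that P(3) by blast+
      then show ?thesis using p(2)[of x y] by (simp add: q_def)
    qed
    moreover have "dist x y < inverse (Suc n)" if "L \<in> levels S P" "x \<in> L" "y \<in> L" for L x y
      proof -
      have "x \<in> Y" "y \<in> Y" "q x = q y" using LY[OF that(1)] const that by blast+
      then show ?thesis using p(2)[of x y] by (simp add: q_def)
    qed
    ultimately have "good n P" unfolding good_def using P(1,2) by blast
    moreover have "x \<in> L" if "x \<in> tower_base P" "L \<in> F" "u \<in> L" for x L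
    proof -
      have "q x = q u" using that P(3) by blast
      then show ?thesis using that(2,3) by (auto simp: q_def)
    qed
    moreover have "L' \<subseteq> L" if "L' \<in> levels S P" "L \<in> F" "L' \<inter> L \<noteq> {}" for L' L
    proof
      fix y assume "y \<in> L'"
      moreover obtain x where "x \<in> L'" "x \<in> L" using \<open>L' \<inter> L \<noteq> {}\<close> by blast
      ultimately have "q x = q y" using const that(1) by blast
      then show "y \<in> L" using that(2) \<open>x \<in> L\<close> by (auto simp: q_def)
    qed
    ultimately show ?thesis by blast
  qed
  have "\<exists>P. \<forall>n. good n (P n) \<and> finer (P n) (P (Suc n))"
  proof (rule dependent_nat_choice)
    obtain u where "u \<in> Y" using nonempty by blast
    then show "\<exists>P. good 0 P" using step[of "{}" u 0] by auto
  next
    fix P n assume "good n P"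
    then have P: "KR_partition Y S P" by (simp add: good_def)
    then have fin: "finite P" and part: "partition_on Y (levels S P)"
      and clopen: "\<And>L. L \<in> levels S P \<Longrightarrow> openin (top_of_set Y) L" "\<And>L. L \<in> levels S P \<Longrightarrow> closedin (top_of_set Y) L"
      unfolding KR_partition_def by blast+
    \<comment> \<open>The new base is placed near a point of the old one; it then lies in a single
      \<open>B\<close>, which is itself a level.\<close>
    obtain u where u: "u \<in> tower_base P" using tower_base_nonempty[OF P] by blast
    then obtain B h where B: "(B, h) \<in> P" "u \<in> B" unfolding tower_base_def by auto
    have "0 < h" using P B(1) unfolding KR_partition_def by auto
    then have BL: "B \<in> levels S P" using levelI[OF B(1), where T = S and j = 0] by simp
    have "u \<in> Y" using u tower_base_clopen(2)[OF P] by blast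
    then obtain P' where P': "good (Suc n) P'" "\<And>x L. x \<in> tower_base P' \<Longrightarrow> L \<in> levels S P \<Longrightarrow> u \<in> L \<Longrightarrow> x \<in> L"
      "\<And>L' L. L' \<in> levels S P' \<Longrightarrow> L \<in> levels S P \<Longrightarrow> L' \<inter> L \<noteq> {} \<Longrightarrow> L' \<subseteq> L"
      using step[OF finite_levels[OF fin] clopen, of u "Suc n"] by metis
    have part': "partition_on Y (levels S P')" using P'(1) unfolding good_def KR_partition_def by blast
    have "tower_base P' \<subseteq> B" using P'(2)[OF _ BL B(2)] by blast
    then have "tower_base P' \<subseteq> tower_base P" using B(1) unfolding tower_base_def by force
    moreover have "\<exists>L\<in>levels S P. L' \<subseteq> L" if L': "L' \<in> levels S P'" for L'
    proof -
      obtain x where x: "x \<in> L'" using L' partition_onD3[OF part'] by (metis ex_in_conv)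
      then have "x \<in> Y" using L' partition_onD1[OF part'] by blast
      then obtain L where "L \<in> levels S P" "x \<in> L" using partition_onD1[OF part] by blast
      then show ?thesis using P'(3)[OF L'] x by blast
    qed
    ultimately have "finer P P'" unfolding finer_def refines_def using part part' by blast
    then show "\<exists>P'. good (Suc n) P' \<and> finer P P'" using P'(1) by blast
  qed
  then obtain P where P: "\<And>n. good n (P n)" "\<And>n. finer (P n) (P (Suc n))" by blast
  have "realization Y S P"
    using P unfolding good_def finer_def by (intro realization_of_small_partitions) blast+
  moreover have "max_towers P \<le> enat K"
    unfolding max_towers_def using P(1) by (intro SUP_least) (simp add: good_def)
  then have "max_towers P < \<infinity>" using enat_ord_code(4) le_less_trans by blast
  ultimately show ?thesis unfolding finite_topological_rank_def by blast
qed

end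

text \<open>The image is compact and contains the full orbit of a point, which is dense; negative
  times need equivariance of the inverses.\<close>

lemma factor_map_surjective:
  assumes X: "homeo_system X T T'" "X \<noteq> {}" and Y: "minimal_homeo_system Y S S'"
    and \<alpha>: "continuous_on X \<alpha>" "\<alpha> ` X \<subseteq> Y" "\<And>x. x \<in> X \<Longrightarrow> \<alpha> (T x) = S (\<alpha> x)"
  shows "\<alpha> ` X = Y"
proof -
  interpret X: homeo_system X T T' by fact
  interpret Y: minimal_homeo_system Y S S' by fact
  obtain x where x: "x \<in> X" using X(2) by blast
  have fwd: "(S ^^ n) (\<alpha> x) = \<alpha> ((T ^^ n) x)" for n
    by (induction n) (simp_all add: \<alpha>(3) x)
  have "S' (\<alpha> z) = \<alpha> (T' z)" if z: "z \<in> X" for z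
  proof -
    have "\<alpha> z = S (\<alpha> (T' z))" using \<alpha>(3)[of "T' z"] z by simp
    then show ?thesis using \<alpha>(2) z by (metis X.maps(2) Y.inverses(1) image_subset_iff)
  qed
  then have bwd: "(S' ^^ n) (\<alpha> x) = \<alpha> ((T' ^^ n) x)" for n
    by (induction n) (simp_all add: x)
  have \<alpha>x: "\<alpha> x \<in> Y" using x \<alpha>(2) by blast
  have "int_iterate Y S n (\<alpha> x) \<in> \<alpha> ` X" for n
    using fwd bwd x \<alpha>x by (auto simp: int_iterate_def Y.inv_into_iterate)
  then have "full_orbit Y S (\<alpha> x) \<subseteq> \<alpha> ` X" unfolding full_orbit_def by blast
  moreover have "closed (\<alpha> ` X)"
    using X.compact_space \<alpha>(1) by (intro compact_imp_closed compact_continuous_image)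
  ultimately have "closure (full_orbit Y S (\<alpha> x)) \<subseteq> \<alpha> ` X" by (rule closure_minimal)
  then have "Y \<subseteq> \<alpha> ` X" using Y.minimal \<alpha>x unfolding minimal_system_def by blast
  then show ?thesis using \<alpha>(2) by blast
qed

theorem theorem1p1:
  fixes X :: "'a::metric_space set" and T :: "'a \<Rightarrow> 'a"
    and Y :: "'b::metric_space set" and S :: "'b \<Rightarrow> 'b"
    and \<alpha> :: "'a \<Rightarrow> 'b"
  assumes "cantor_system X T"
    and "essentially_minimal X T"
    and "finite_topological_rank X T"
    and "cantor_space Y"
    and "minimal_system Y S"
    and "continuous_on X \<alpha>"
    and "\<alpha> ` X \<subseteq> Y"
    and "\<And>x. x \<in> X \<Longrightarrow> \<alpha> (T x) = S (\<alpha> x)"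
  shows "topological_rank Y S < \<infinity>"
proof -
  obtain T' where X: "X \<noteq> {}" "compact X" "homeomorphism X X T T'"
    using assms(1) unfolding cantor_system_def dynamical_system_def by blast
  interpret X: homeo_system X T T' using X by unfold_locales
  obtain S' where "homeomorphism Y Y S S'" "compact Y"
    using assms(5) unfolding minimal_system_def dynamical_system_def by blast
  then interpret Y: minimal_homeo_system Y S S' using assms(5) by unfold_locales
  have surj: "\<alpha> ` X = Y"
    using factor_map_surjective X.homeo_system_axioms X(1) Y.minimal_homeo_system_axioms assms(6-8)
    by blast
  have equiv: "(S ^^ n) (\<alpha> x) = \<alpha> ((T ^^ n) x)" if "x \<in> X" for n x
    using that by (induction n) (simp_all add: assms(8))
  obtain P where P: "realization X T P" "max_towers P < \<infinity>"
    using assms(3) unfolding finite_topological_rank_def by blast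
  obtain d where d: "max_towers P = enat d" using P(2) by (cases "max_towers P") auto
  have "enat (card (P n)) \<le> max_towers P" for n unfolding max_towers_def by (rule SUP_upper) simp
  then have card: "card (P n) \<le> d" for n unfolding d by simp
  have "finite_topological_rank Y S"
  proof (rule Y.finite_topological_rankI)
    show "totally_disconnected Y" using assms(4) unfolding cantor_space_def by blast
  next
    fix q :: "'b \<Rightarrow> 'b set set \<times> 'b set set" and u
    assume q: "locally_constant_on Y q" and u: "u \<in> Y"
    show "\<exists>P. KR_partition Y S P \<and> card P \<le> (2 ^ d\<^sup>2 + 1) * d \<and> tower_base P \<subseteq> {y \<in> Y. q y = q u} \<and>
        (\<forall>L\<in>levels S P. \<forall>x\<in>L. \<forall>y\<in>L. q x = q y)"
    proof (rule Y.KR_partition_of_words[OF q u])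
      fix f :: "'b \<Rightarrow> ('b set set \<times> 'b set set) list"
      assume "locally_constant_on Y f"
      then have "locally_constant_on X (\<lambda>x. f (\<alpha> x))"
        using assms(6,7) by (rule locally_constant_on_compose)
      \<comment> \<open>The stage \<open>n\<close> depends on \<open>f\<close>, but its number of
        towers is at most \<open>d\<close> in any case.\<close>
      then obtain n where n: "\<forall>L\<in>levels T (P n). \<forall>x\<in>L. \<forall>y\<in>L. f (\<alpha> x) = f (\<alpha> y)"
        using realization_constant_on_levels[OF X(2) P(1)] by blast
      have "KR_partition X T (P n)" using P(1) unfolding realization_def by blast
      then have "\<exists>W. finite W \<and> card W \<le> card (P n) \<and> [] \<notin> W \<and>
          (\<forall>x\<in>X. \<forall>k. \<exists>v\<in>concats W. sublist (itinerary T (\<lambda>x. f (\<alpha> x)) k x) v)"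
        by (rule X.tower_words) (use n in blast)
      then obtain W where W: "finite W" "card W \<le> card (P n)" "[] \<notin> W"
        "\<And>x k. x \<in> X \<Longrightarrow> \<exists>v\<in>concats W. sublist (itinerary T (\<lambda>x. f (\<alpha> x)) k x) v"
        by blast
      have "\<exists>v\<in>concats W. sublist (itinerary S f k y) v" if "y \<in> Y" for y k
      proof -
        \<comment> \<open>Surjectivity turns every itinerary in \<open>Y\<close> into one of a point
          of \<open>X\<close>, coded by \<open>f\<close> after \<open>\<alpha>\<close>.\<close>
        obtain x where x: "x \<in> X" "y = \<alpha> x" using \<open>y \<in> Y\<close> surj by blast
        have eq: "itinerary S f k y = itinerary T (\<lambda>x. f (\<alpha> x)) k x" using x equiv by simp
        show ?thesis unfolding eq by (rule W(4)[OF x(1)])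
      qed
      moreover have "card W \<le> d" using W(2) card[of n] by simp
      ultimately show "\<exists>W. finite W \<and> card W \<le> d \<and> [] \<notin> W \<and>
          (\<forall>y\<in>Y. \<forall>k. \<exists>v\<in>concats W. sublist (itinerary S f k y) v)"
        using W(1,3) by blast
    qed
  qed
  then show ?thesis using topological_rank_less_infinity_iff by blast
qed

end
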